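(* Let $s(X)\in X\mathcal{O}_K[[X]]$ be of finite height, with substitution $\phi$ on the Robba ring $\mathcal{R}$. If $\mu\in K$, $\mu\neq1$, and $h\in\mathcal{R}$ is nonzero with $\phi(h)=\mu h$, then $s'(0)\neq0$, and there exists an integer $k\ge1$ such that $\mu=s'(0)^k$ and $h\in K\cdot\log_s^k$.
   Context: Let $k$ be a perfect field of characteristic $p$ and $K$ a finite totally ramified extension of $W(k)[1/p]$, with ring of integers $\mathcal{O}_K$, maximal ideal $\mathfrak{m}_K$, uniformizer $\pi$ and $p$-adic absolute value $|\cdot|$. For $I\subset[0,1)$, $\mathcal{R}^I$ is the ring of Laurent series $\sum_{n\in\mathbf{Z}}a_nX^n$, $a_n\in K$, with $|a_n|r^n\to0$ as $n\to\pm\infty$ for all $r\in I$; $|a|_r=\sup_n|a_n|r^n$. $\mathcal{R}^+=\mathcal{R}^{[0;1[}$ and $\mathcal{R}=\bigcup_{r<1}\mathcal{R}^{[r;1[}$. Finite height: $s(X)=\sum_{k\ge1}s_kX^k$ with, for some $d\ge2$, $s_1,\dots,s_{d-1}\in\mathfrak{m}_K$, $s_d\in\mathcal{O}_K^\times$. $\phi:h(X)\mapsto h(s(X))$ on $\mathcal{R}^+$, extended to $\mathcal{R}$: for $r<1$ close to $1$ it maps $\mathcal{R}^{[r;1[}$ into $\mathcal{R}^{[r^{1/d};1[}$ with $\phi(h)(z)=h(s(z))$ for $r^{1/d}\le|z|<1$ (explicitly $\phi(\sum h_nX^n)=\sum h_ns_d^nX^{dn}(1+g)^n$ with $s=s_dX^d(1+g)$,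 $|g|_r<1$, binomial expansion). If $s'(0)\neq0$, $\log_s(X)=X\prod_{i\ge0}r(s^{\circ i}(X))\in X\mathcal{R}^+$ where $r(X)=s(X)/(s'(0)X)$; it satisfies $\phi(\log_s)=s'(0)\log_s$. *)

theory Defs
  imports "HOL-Analysis.Analysis" "HOL-Computational_Algebra.Computational_Algebra"
begin

section \<open>The field $K$\<close>

text \<open>The library's \<open>norm\<close> is reserved for real normed vector spaces, hence \<open>vabs\<close>.
  Completeness and discreteness of the absolute value are not part of the class: for the fields
  considered below they follow from finiteness over $W(k)[1/p]$.\<close>

class nonarch_field = field_char_0 + metric_space +
  fixes vabs :: "'a \<Rightarrow> real"
  assumes dist_vabs: "dist x y = vabs (x - y)"
    and vabs_mult: "vabs (x * y) = vabs x * vabs y"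
    and vabs_add: "vabs (x + y) \<le> max (vabs x) (vabs y)"

text \<open>For \<open>k\<close> perfect of characteristic \<open>p\<close>, the ring $W(k)$ is, up to unique isomorphism, the
  $p$-torsion free, $p$-adically separated and complete ring with residue ring $W/pW = k$ (Serre,
  Corps locaux, II.5).  A copy of it inside \<open>K\<close> is a subring \<open>W\<close> with these properties,
  torsion-freeness being automatic in characteristic 0.  The map \<open>red\<close> is only relevant on \<open>W\<close>.\<close>

locale witt_subring =
  fixes p :: nat and W :: "'a::field_char_0 set" and red :: "'a \<Rightarrow> 'k::field"
  assumes prime_p: "prime p"
    and char_k: "CHAR('k) = p"
    and perfect_k: "\<forall>a::'k. \<exists>b. b ^ p = a"
    and one_W: "1 \<in> W"
    and diff_W: "x \<in> W \<Longrightarrow> y \<in> W \<Longrightarrow> x - y \<in> W"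
    and mult_W: "x \<in> W \<Longrightarrow> y \<in> W \<Longrightarrow> x * y \<in> W"
    and red_one: "red 1 = 1"
    and red_add: "x \<in> W \<Longrightarrow> y \<in> W \<Longrightarrow> red (x + y) = red x + red y"
    and red_mult: "x \<in> W \<Longrightarrow> y \<in> W \<Longrightarrow> red (x * y) = red x * red y"
    and red_surj: "red ` W = UNIV"
    and red_kernel: "x \<in> W \<Longrightarrow> red x = 0 \<longleftrightarrow> (\<exists>y\<in>W. x = of_nat p * y)"
    and separated_W: "x \<in> W \<Longrightarrow> (\<And>n. \<exists>y\<in>W. x = of_nat p ^ n * y) \<Longrightarrow> x = 0"
    and complete_W: "(\<And>n. u n \<in> W) \<Longrightarrow> (\<And>n. \<exists>y\<in>W. u (Suc n) - u n = of_nat p ^ n * y)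
        \<Longrightarrow> \<exists>x\<in>W. \<forall>n. \<exists>y\<in>W. x - u n = of_nat p ^ n * y"

text \<open>$W[1/p]$, the fraction field of \<open>W\<close>.\<close>

definition invert_p :: "nat \<Rightarrow> 'a::field_char_0 set \<Rightarrow> 'a set" where
  "invert_p p W = {w / of_nat p ^ n | w n. w \<in> W}"

text \<open>The whole type \<open>'a\<close> is a finite totally ramified extension of $W[1/p]$, and \<open>vabs\<close> is the
  $p$-adic absolute value.  Without \<open>vabs_unit\<close>, \<open>vabs\<close> might restrict to \<open>W\<close> as
  an absolute value unrelated to the $p$-adic one, even with \<open>vabs_p\<close>.  Totally ramified means that
  the residue field is still \<open>k\<close>, i.e. \<open>W\<close> maps onto
  $\mathcal{O}_K/\mathfrak{m}_K$.\<close>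

locale totally_ramified_over_witt = witt_subring p W red
  for p :: nat and W :: "'a::nonarch_field set" and red :: "'a \<Rightarrow> 'k::field" +
  assumes finite_ext: "\<exists>B. finite B \<and>
        (\<forall>x. \<exists>c. (\<forall>b\<in>B. c b \<in> invert_p p W) \<and> x = (\<Sum>b\<in>B. c b * b))"
    and vabs_p: "vabs (of_nat p :: 'a) = 1 / real p"
    and vabs_unit: "w \<in> W \<Longrightarrow> (\<nexists>y. y \<in> W \<and> w = of_nat p * y) \<Longrightarrow> vabs w = 1"
    and totally_ramified: "vabs x \<le> 1 \<Longrightarrow> \<exists>w\<in>W. vabs (x - w) < 1"

section \<open>The Robba ring\<close>

text \<open>A bi-infinite Laurent series $\sum_{n\in\mathbf{Z}} a_n X^n$ is represented by its coefficient
  function.  For \<open>r = 0\<close> and \<open>n < 0\<close> one has $r^n = \infty$, so convergence at \<open>0\<close> means that there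
  are no negative powers of $X$; this has to be spelled out because \<open>0 powi n = 0\<close> in HOL.\<close>

definition laurent_on :: "real set \<Rightarrow> (int \<Rightarrow> 'a::nonarch_field) set" where
  "laurent_on I = {a. \<forall>r\<in>I.
     (\<lambda>n. vabs (a (int n)) * r ^ n) \<longlonglongrightarrow> 0 \<and>
     (if r = 0 then \<forall>n<0. a n = 0
      else (\<lambda>n. vabs (a (- int n)) * r powi (- int n)) \<longlonglongrightarrow> 0)}"

definition robba :: "(int \<Rightarrow> 'a::nonarch_field) set" where
  "robba = (\<Union>r\<in>{0..<1}. laurent_on {r..<1})"

section \<open>Series of finite height and substitution\<close>

definition finite_height :: "nat \<Rightarrow> 'a::nonarch_field fps \<Rightarrow> bool" where
  "finite_height d s \<longleftrightarrow> d \<ge> 2 \<and> fps_nth s 0 = 0 \<and> (\<forall>i. vabs (fps_nth s i) \<le> 1) \<and>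
     (\<forall>i\<in>{1..<d}. vabs (fps_nth s i) < 1) \<and> vabs (fps_nth s d) = 1"

text \<open>The $g$ with $s = s_d X^d (1 + g)$.  It has finitely many negative powers of $X$, so it and
  its powers $g^j$ can be formed as formal Laurent series.\<close>

definition height_rem :: "nat \<Rightarrow> 'a::nonarch_field fps \<Rightarrow> 'a fls" where
  "height_rem d s = fls_shift (int d) (fps_to_fls (fps_const (inverse (fps_nth s d)) * s)) - 1"

text \<open>Coefficient of $X^m$ in $(1+g)^n = \sum_{j\ge 0} \binom{n}{j} g^j$, the sum being
  taken in \<open>K\<close>.  For \<open>n < 0\<close> this is the inverse on an annulus near the unit circle; it differs from
  \<open>(1 + g) powi n\<close> in the field of formal Laurent series, which expands around $X = 0$.\<close>

definition binomial_coeff :: "'a::nonarch_field fls \<Rightarrow> int \<Rightarrow> int \<Rightarrow> 'a" where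
  "binomial_coeff g n m = (\<Sum>\<^sub>\<infinity>j. (of_int n gchoose j) * fls_nth (g ^ j) m)"

text \<open>$\phi(\sum_n h_n X^n) = \sum_n h_n s_d^n X^{dn} (1+g)^n$, coefficient by coefficient.\<close>

definition phi :: "nat \<Rightarrow> 'a::nonarch_field fps \<Rightarrow> (int \<Rightarrow> 'a) \<Rightarrow> (int \<Rightarrow> 'a)" where
  "phi d s h = (\<lambda>m. \<Sum>\<^sub>\<infinity>n. h n * fps_nth s d powi n *
      binomial_coeff (height_rem d s) n (m - int d * n))"

section \<open>The logarithm\<close>

definition iter_series :: "'a::nonarch_field fps \<Rightarrow> nat \<Rightarrow> 'a fps" where
  "iter_series s i = ((\<lambda>f. s oo f) ^^ i) fps_X"

definition ratio_series :: "'a::nonarch_field fps \<Rightarrow> 'a fps" where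
  "ratio_series s = s / (fps_const (fps_nth (fps_deriv s) 0) * fps_X)"

text \<open>The partial products converge for all norms $|\cdot|_r$ with \<open>r < 1\<close>, hence coefficientwise in
  \<open>K\<close>, and the limit is determined by its coefficients.  (The library's limits of formal power series
  are for the $X$-adic metric and do not apply here.)\<close>

definition log_series :: "'a::nonarch_field fps \<Rightarrow> 'a fps" where
  "log_series s = Abs_fps (\<lambda>n. lim (\<lambda>N.
     fps_nth (fps_X * (\<Prod>i<N. ratio_series s oo iter_series s i)) n))"

definition laurent_of_fps :: "'a::zero fps \<Rightarrow> int \<Rightarrow> 'a" where
  "laurent_of_fps f = fls_nth (fps_to_fls f)"

end

theory Submission
  imports Defs
begin

text \<open>Near the unit circle $|\phi(h)|_\rho \le |h|_{\rho^d}$, so an eigenvalue with $|\mu| > 1$ would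
  force $|h|_\rho \to 0$ as $\rho \to 1$.  If $|\mu| \le 1$ and \<open>h\<close> has a nonzero principal part, the
  latter is bounded and, scaled to norm 1, reduces to a polynomial in $X^{-1}$ with a pole of some
  order $N > 0$; since \<open>s\<close> reduces to $s_d X^d$ times a series with constant term 1, $\phi(h)$ has a
  coefficient of the same size in degree $-dN$, where $\mu h$ has only smaller ones.  Hence \<open>h\<close> is a
  power series with $h \circ s = \mu h$.  Comparing lowest terms gives $s'(0) \ne 0$ and
  $\mu = s'(0)^k$, and since $s'(0)$ is not a root of unity the solution is unique up to a scalar;
  $\log_s^k$ is one.\<close>

section \<open>Nonarchimedean absolute values\<close>

text \<open>The series defining \<phi> are values of \<open>infsum\<close> in K, which is 0 when a
  sum diverges. Upper bounds therefore survive without any convergence, but the persistence of a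
  leading pole is a lower bound: there the sums must converge, and this is why completeness of K is
  extracted from finiteness over W[1/p]. All estimates rest on one property of the g in s = s_d X^d
  (1 + g): |g|_\<rho> \<le> \<rho> for every \<rho> in some interval
  [\<open>\<rho>\<^sub>0\<close>, 1]. Radii below 1 make the binomial series converge, also for
  negative exponents; radius 1 bounds its coefficients by 1. The logarithm is treated formally: a
  series l = X + ... with l(s) = s'(0) l is built by recursion on its coefficients, so that
  uniqueness of eigenvectors is pure algebra, and analysis enters only to identify l with the limit
  of the partial products.\<close>

lemma vabs_zero [simp]: "vabs (0::'a::nonarch_field) = 0"
  by (metis dist_self dist_vabs diff_self)

lemma vabs_nonneg [simp]: "0 \<le> vabs (x::'a::nonarch_field)"
  by (metis dist_vabs diff_zero zero_le_dist)

lemma vabs_eq_0_iff [simp]: "vabs (x::'a::nonarch_field) = 0 \<longleftrightarrow> x = 0"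
  by (metis dist_eq_0_iff dist_vabs diff_zero)

lemma vabs_pos_iff [simp]: "0 < vabs (x::'a::nonarch_field) \<longleftrightarrow> x \<noteq> 0"
  by (simp add: order_less_le)

lemma vabs_one [simp]: "vabs (1::'a::nonarch_field) = 1"
  by (metis vabs_mult mult_cancel_left2 vabs_eq_0_iff zero_neq_one mult_1)

lemma vabs_minus [simp]: "vabs (- x) = vabs (x::'a::nonarch_field)"
  by (metis dist_commute dist_vabs diff_zero minus_diff_eq)

lemma vabs_minus_commute: "vabs (x - y) = vabs (y - x :: 'a::nonarch_field)"
  by (metis vabs_minus minus_diff_eq)

lemma vabs_diff: "vabs (x - y) \<le> max (vabs x) (vabs (y::'a::nonarch_field))"
  using vabs_add[of x "- y"] by simp

lemma vabs_power: "vabs (x ^ n) = vabs (x::'a::nonarch_field) ^ n"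
  by (induction n) (simp_all add: vabs_mult)

lemma vabs_inverse: "vabs (inverse x) = inverse (vabs (x::'a::nonarch_field))"
proof (cases "x = 0")
  case False
  then have "vabs x * vabs (inverse x) = 1" by (metis right_inverse vabs_mult vabs_one)
  then show ?thesis by (simp add: inverse_unique)
qed simp

lemma vabs_divide: "vabs (x / y) = vabs x / vabs (y::'a::nonarch_field)"
  by (simp add: divide_inverse vabs_mult vabs_inverse)

lemma vabs_power_int: "vabs (x powi n) = vabs (x::'a::nonarch_field) powi n"
  by (cases n rule: int_cases2) (simp_all add: power_int_minus vabs_power vabs_inverse)

lemma vabs_sum_le:
  assumes "\<And>x. x \<in> A \<Longrightarrow> vabs (f x :: 'a::nonarch_field) \<le> B" "0 \<le> B"
  shows "vabs (sum f A) \<le> B"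
  using assms
proof (induction A rule: infinite_finite_induct)
  case (insert x F)
  then show ?case using vabs_add[of "f x" "sum f F"] by fastforce
qed auto

lemma vabs_sum_less:
  assumes "\<And>x. x \<in> A \<Longrightarrow> vabs (f x :: 'a::nonarch_field) < B" "0 < B"
  shows "vabs (sum f A) < B"
  using assms
proof (induction A rule: infinite_finite_induct)
  case (insert x F)
  then have "max (vabs (f x)) (vabs (sum f F)) < B" by simp
  with vabs_add[of "f x" "sum f F"] have "vabs (f x + sum f F) < B" by (rule le_less_trans)
  then show ?case using insert by simp
qed auto

lemma vabs_eq_of_diff_less:
  assumes "vabs (x - y) < vabs (y::'a::nonarch_field)"
  shows "vabs x = vabs y"
  using vabs_add[of "x - y" y] vabs_diff[of x "x - y"] assms by simp

lemma vabs_of_nat: "vabs (of_nat n :: 'a::nonarch_field) \<le> 1"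
proof (induction n)
  case (Suc n)
  then show ?case using vabs_add[of "1::'a" "of_nat n"] by simp
qed simp

text \<open>These are integers: ordinary binomial coefficients for n \<ge> 0, and by reflection
  \<open>(-1)^j * (j - n - 1 choose j)\<close> for n < 0. This bound is what lets negative powers of
  1 + g be estimated like positive ones.\<close>

lemma vabs_gbinomial: "vabs (of_int n gchoose j :: 'a::nonarch_field) \<le> 1"
proof (cases "n \<ge> 0")
  case True
  then have "(of_int n gchoose j :: 'a) = of_nat (nat n choose j)"
    by (simp add: binomial_gbinomial)
  then show ?thesis using vabs_of_nat by metis
next
  case False
  define k where "k = nat (- n)"
  have n: "of_int n = - (of_nat k :: 'a)" and k: "k > 0" using False by (simp_all add: k_def)
  have "(of_int n gchoose j :: 'a) = (-1) ^ j * (of_nat (k + j - 1) gchoose j)"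
    using k by (simp add: n gbinomial_minus of_nat_diff)
  also have "\<dots> = (-1) ^ j * of_nat ((k + j - 1) choose j)"
    by (simp only: binomial_gbinomial)
  finally show ?thesis
    by (metis vabs_mult vabs_power vabs_minus vabs_one power_one mult_1 vabs_of_nat)
qed

section \<open>Limits and infinite sums for an ultrametric absolute value\<close>

lemma tendsto_iff_vabs:
  fixes f :: "'b \<Rightarrow> 'a::nonarch_field"
  shows "(f \<longlongrightarrow> l) F \<longleftrightarrow> ((\<lambda>x. vabs (f x - l)) \<longlongrightarrow> 0) F"
  using tendsto_dist_iff[of f l F] by (simp add: dist_vabs)

text \<open>Strictness needs no uniform bound below M: up to an error less than M the sum is a
  finite one containing the term at a, and finitely many terms below M add up to less than M. Used
  to show that a single term dominates a series.\<close>

lemma has_sum_vabs_diff_less: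
  fixes f :: "'b \<Rightarrow> 'a::nonarch_field"
  assumes sum: "(f has_sum S) A" and a: "a \<in> A" and M: "0 < M"
    and less: "\<And>x. x \<in> A - {a} \<Longrightarrow> vabs (f x) < M"
  shows "vabs (S - f a) < M"
proof -
  have "\<forall>\<^sub>F X in finite_subsets_at_top A. dist (sum f X) S < M"
    using sum M by (simp add: has_sum_def tendsto_iff)
  then obtain X where X: "finite X" "\<And>Y. finite Y \<Longrightarrow> X \<subseteq> Y \<Longrightarrow> Y \<subseteq> A \<Longrightarrow> dist (sum f Y) S < M"
    "X \<subseteq> A"
    by (auto simp: eventually_finite_subsets_at_top)
  define Y where "Y = insert a X"
  have Y: "finite Y" "a \<in> Y" "Y \<subseteq> A" using X a by (auto simp: Y_def)
  have "vabs (sum f Y - S) < M" using X(2)[of Y] Y by (auto simp: dist_vabs Y_def)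
  moreover have "sum f Y = f a + sum f (Y - {a})" using Y by (simp add: sum.remove)
  moreover have "vabs (sum f (Y - {a})) < M" using Y less M by (intro vabs_sum_less) auto
  moreover have "S - f a = sum f (Y - {a}) - (sum f Y - S)" using calculation(2) by simp
  ultimately show ?thesis
    using vabs_diff[of "sum f (Y - {a})" "sum f Y - S"] by simp
qed

text \<open>A divergent sum has the default value 0, which also obeys the bound; hence no
  summability is required.\<close>

lemma infsum_vabs_le:
  fixes f :: "'b \<Rightarrow> 'a::nonarch_field"
  assumes le: "\<And>x. x \<in> A \<Longrightarrow> vabs (f x) \<le> B" and B: "0 \<le> B"
  shows "vabs (infsum f A) \<le> B"
proof (cases "f summable_on A")
  case True
  show ?thesis
  proof (rule field_le_epsilon)
    fix e :: real assume e: "e > 0"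
    have "\<forall>\<^sub>F X in finite_subsets_at_top A. dist (sum f X) (infsum f A) < e"
      using has_sum_infsum[OF True] e by (simp add: has_sum_def tendsto_iff)
    then obtain X where "finite X" "X \<subseteq> A" "dist (sum f X) (infsum f A) < e"
      unfolding eventually_finite_subsets_at_top by blast
    moreover have "vabs (sum f X) \<le> B" using calculation le B by (intro vabs_sum_le) auto
    ultimately show "vabs (infsum f A) \<le> B + e"
      using vabs_diff[of "sum f X" "sum f X - infsum f A"] B e by (simp add: dist_vabs)
  qed
qed (simp add: infsum_not_exists B)

text \<open>In a complete ultrametric field it suffices that the terms tend to 0. The sums over the
  finite sets \<open>F n\<close> of terms of size at least 1/(n+1) form a Cauchy sequence, since
  enlarging \<open>F n\<close> changes the sum by less than 1/(n+1).\<close>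

lemma nonarch_summable_on:
  fixes f :: "'b \<Rightarrow> 'a::nonarch_field"
  assumes complete: "complete (UNIV :: 'a set)"
    and fin: "\<And>e. e > 0 \<Longrightarrow> finite {x \<in> A. vabs (f x) \<ge> e}"
  shows "f summable_on A"
proof -
  define F where "F = (\<lambda>n::nat. {x \<in> A. vabs (f x) \<ge> inverse (Suc n)})"
  have finF: "finite (F n)" for n unfolding F_def by (rule fin) simp
  have near: "vabs (sum f Y - sum f (F n)) < inverse (Suc n)"
    if "finite Y" "F n \<subseteq> Y" "Y \<subseteq> A" for Y n
  proof -
    have "sum f Y - sum f (F n) = sum f (Y - F n)" using that by (simp add: sum_diff)
    also have "vabs \<dots> < inverse (Suc n)" using that by (intro vabs_sum_less) (auto simp: F_def)
    finally show ?thesis .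
  qed
  have mono: "F m \<subseteq> F n" if "m \<le> n" for m n
  proof -
    have "inverse (real (Suc n)) \<le> inverse (real (Suc m))" using that by simp
    then show ?thesis unfolding F_def by (blast intro: order_trans)
  qed
  have "Cauchy (\<lambda>n. sum f (F n))"
  proof (rule metric_CauchyI)
    fix e :: real assume "e > 0"
    then obtain N where N: "inverse (Suc N) < e" using reals_Archimedean by blast
    have "dist (sum f (F m)) (sum f (F n)) < e" if "m \<ge> N" "n \<ge> N" for m n
    proof -
      have "vabs (sum f (F k) - sum f (F N)) < e" if "k \<ge> N" for k
        using near[OF finF mono[OF that]] N by (force simp: F_def)
      then have "max (vabs (sum f (F m) - sum f (F N))) (vabs (sum f (F n) - sum f (F N))) < e"
        using that by simp
      with vabs_diff have "vabs ((sum f (F m) - sum f (F N)) - (sum f (F n) - sum f (F N))) < e"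
        by (rule le_less_trans)
      then show ?thesis by (simp add: dist_vabs)
    qed
    then show "\<exists>M. \<forall>m\<ge>M. \<forall>n\<ge>M. dist (sum f (F m)) (sum f (F n)) < e" by blast
  qed
  then obtain l where l: "(\<lambda>n. sum f (F n)) \<longlonglongrightarrow> l"
    using completeE[OF complete, of "\<lambda>n. sum f (F n)"] by blast
  have "(f has_sum l) A"
    unfolding has_sum_def tendsto_iff
  proof (intro allI impI)
    fix e :: real assume e: "e > 0"
    then obtain N where N: "inverse (Suc N) < e" using reals_Archimedean by blast
    obtain M where M: "\<And>n. n \<ge> M \<Longrightarrow> vabs (sum f (F n) - l) < e"
      using metric_LIMSEQ_D[OF l e] by (auto simp: dist_vabs)
    define n where "n = max M N"
    have n: "inverse (Suc n) < e"
      using le_imp_inverse_le[of "Suc N" "Suc n"] by (intro le_less_trans[OF _ N]) (simp add: n_def)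
    have "dist (sum f Y) l < e" if "finite Y" "F n \<subseteq> Y" "Y \<subseteq> A" for Y
      using near[OF that] n M[of n] vabs_add[of "sum f Y - sum f (F n)" "sum f (F n) - l"]
      by (simp add: dist_vabs n_def)
    then show "\<forall>\<^sub>F x in finite_subsets_at_top A. dist (sum f x) l < e"
      unfolding eventually_finite_subsets_at_top using finF
      by (intro exI[of _ "F n"]) (auto simp: F_def)
  qed
  then show ?thesis by (auto simp: summable_on_def)
qed

section \<open>Completeness of \<open>K\<close>\<close>

context totally_ramified_over_witt
begin

section \<open>Divisibility by p and units in W\<close>

lemma p_gt_1: "p > 1"
  using prime_p by (rule prime_gt_1_nat)

lemma p_nonzero: "(of_nat p :: 'a) \<noteq> 0"
  using p_gt_1 by simp

lemma zero_W: "0 \<in> W"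
  using diff_W[OF one_W one_W] by simp

lemma uminus_W: "x \<in> W \<Longrightarrow> - x \<in> W"
  using diff_W[OF zero_W, of x] by simp

lemma add_W: "x \<in> W \<Longrightarrow> y \<in> W \<Longrightarrow> x + y \<in> W"
  using diff_W[of x "- y"] uminus_W[of y] by simp

lemma of_nat_W: "of_nat n \<in> W"
  by (induction n) (auto intro: zero_W one_W add_W)

lemma power_W: "x \<in> W \<Longrightarrow> x ^ n \<in> W"
  by (induction n) (auto intro: one_W mult_W)

lemma sum_W: "(\<And>i. i \<in> A \<Longrightarrow> f i \<in> W) \<Longrightarrow> sum f A \<in> W"
  by (induction A rule: infinite_finite_induct) (auto intro: zero_W add_W)

text \<open>Separatedness provides a power of p not dividing w. The least such exponent is positive,
  because p^0 always divides, and its predecessor is the p-adic valuation of w.\<close>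

lemma W_factor:
  assumes "w \<in> W" "w \<noteq> 0"
  obtains n u where "u \<in> W" "w = of_nat p ^ n * u" "\<nexists>y. y \<in> W \<and> u = of_nat p * y"
proof -
  have ex: "\<exists>n. \<not> (\<exists>y\<in>W. w = of_nat p ^ n * y)" using separated_W[OF assms(1)] assms(2) by blast
  define n where "n = (LEAST n. \<not> (\<exists>y\<in>W. w = of_nat p ^ n * y))"
  have n: "\<not> (\<exists>y\<in>W. w = of_nat p ^ n * y)" unfolding n_def by (rule LeastI_ex[OF ex])
  have "n \<noteq> 0" using n assms(1) by (intro notI) auto
  then obtain m where m: "n = Suc m" by (cases n) auto
  then have "\<exists>y\<in>W. w = of_nat p ^ m * y"
    using not_less_Least[of m "\<lambda>n. \<not> (\<exists>y\<in>W. w = of_nat p ^ n * y)"] n_def by auto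
  then obtain u where u: "u \<in> W" "w = of_nat p ^ m * u" by blast
  moreover have "\<nexists>y. y \<in> W \<and> u = of_nat p * y" using n u m by (auto simp: mult.assoc)
  ultimately show ?thesis using that by blast
qed

lemma vabs_p_power: "vabs (of_nat p ^ n * u :: 'a) = (1 / real p) ^ n * vabs u"
  by (simp add: vabs_mult vabs_power vabs_p)

text \<open>The part of w prime to p has absolute value 1 by \<open>vabs_unit\<close>, so the size
  of w determines its valuation. This turns metric closeness into the congruences that
  \<open>complete_W\<close> asks for.\<close>

lemma W_divisible:
  assumes "w \<in> W" "vabs w \<le> (1 / real p) ^ n"
  shows "\<exists>y\<in>W. w = of_nat p ^ n * y"
proof (cases "w = 0")
  case False
  obtain m u where u: "u \<in> W" "w = of_nat p ^ m * u" "\<nexists>y. y \<in> W \<and> u = of_nat p * y"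
    by (rule W_factor[OF assms(1) False])
  then have "vabs w = (1 / real p) ^ m" using vabs_unit by (simp add: vabs_p_power)
  then have "n \<le> m" using assms(2) p_gt_1 by (simp add: power_decreasing_iff)
  then have "w = of_nat p ^ n * (of_nat p ^ (m - n) * u)"
    using u by (simp flip: mult.assoc power_add)
  then show ?thesis using u mult_W power_W of_nat_W by blast
qed (use zero_W in auto)

text \<open>Lifting the inverse of the residue of u gives v with u v = 1 - p y, and the geometric
  series in p y converges p-adically to an inverse x of u v; then v x inverts u.\<close>

lemma inverse_W:
  assumes u: "u \<in> W" "\<nexists>y. y \<in> W \<and> u = of_nat p * y"
  shows "inverse u \<in> W"
proof -
  have "red u \<noteq> 0" using u red_kernel by blast
  obtain v where v: "v \<in> W" "red v = inverse (red u)" using red_surj by (metis UNIV_I imageE)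
  have uv: "u * v \<in> W" using u v mult_W by blast
  have "red (1 - u * v) + red (u * v) = red 1"
    using red_add[OF diff_W[OF one_W uv] uv] by simp
  then have "red (1 - u * v) = 0" using u v red_mult red_one \<open>red u \<noteq> 0\<close> by simp
  then obtain y where y: "y \<in> W" "1 - u * v = of_nat p * y"
    using red_kernel[OF diff_W[OF one_W uv]] by blast
  define S where "S = (\<lambda>n. \<Sum>i<n. (of_nat p * y) ^ i)"
  have S: "S n \<in> W" for n
    unfolding S_def by (intro sum_W power_W mult_W of_nat_W y)
  have "S (Suc n) - S n = of_nat p ^ n * y ^ n" for n by (simp add: S_def power_mult_distrib)
  then have "\<exists>z\<in>W. S (Suc n) - S n = of_nat p ^ n * z" for n using y power_W by blast
  then obtain x where x: "x \<in> W" "\<And>n. \<exists>z\<in>W. x - S n = of_nat p ^ n * z"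
    using complete_W[of S] S by blast
  have "u * v * x - 1 = 0"
  proof (rule separated_W)
    show "u * v * x - 1 \<in> W" using uv x one_W mult_W diff_W by blast
    fix n
    obtain z where z: "z \<in> W" "x - S n = of_nat p ^ n * z" using x by blast
    have uvp: "u * v = 1 - of_nat p * y" using y by (simp add: algebra_simps)
    have "u * v * S n = 1 - (of_nat p * y) ^ n"
      unfolding uvp S_def by (simp add: one_diff_power_eq)
    moreover have "x = S n + of_nat p ^ n * z" using z by (simp add: algebra_simps)
    then have "u * v * x = u * v * S n + u * v * (of_nat p ^ n * z)" by (metis distrib_left)
    ultimately have "u * v * x - 1 = of_nat p ^ n * (u * v * z - y ^ n)"
      by (simp add: power_mult_distrib algebra_simps)
    then show "\<exists>z\<in>W. u * v * x - 1 = of_nat p ^ n * z"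
      using uv z y mult_W diff_W power_W by blast
  qed
  then have "u * (v * x) = 1" by (simp add: mult.assoc)
  then have "inverse u = v * x" by (rule inverse_unique)
  then show ?thesis using v x mult_W by simp
qed

section \<open>The field W[1/p] and its completeness\<close>

lemma invert_p_iff: "x \<in> invert_p p W \<longleftrightarrow> (\<exists>n. of_nat p ^ n * x \<in> W)"
proof
  assume "x \<in> invert_p p W"
  then obtain w n where "x = w / of_nat p ^ n" "w \<in> W" unfolding invert_p_def by blast
  then show "\<exists>n. of_nat p ^ n * x \<in> W" using p_nonzero by (intro exI[of _ n]) simp
next
  assume "\<exists>n. of_nat p ^ n * x \<in> W"
  then obtain n where "of_nat p ^ n * x \<in> W" by blast
  moreover have "x = (of_nat p ^ n * x) / of_nat p ^ n" using p_nonzero by simp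
  ultimately show "x \<in> invert_p p W" unfolding invert_p_def by blast
qed

lemma W_subset_invert_p: "x \<in> W \<Longrightarrow> x \<in> invert_p p W"
  unfolding invert_p_iff by (intro exI[of _ 0]) simp

lemma mult_invert_p: "x \<in> invert_p p W \<Longrightarrow> y \<in> invert_p p W \<Longrightarrow> x * y \<in> invert_p p W"
proof -
  assume "x \<in> invert_p p W" "y \<in> invert_p p W"
  then obtain m n where "of_nat p ^ m * x \<in> W" "of_nat p ^ n * y \<in> W"
    unfolding invert_p_iff by blast
  from mult_W[OF this] have "of_nat p ^ (m + n) * (x * y) \<in> W" by (simp add: power_add ac_simps)
  then show ?thesis unfolding invert_p_iff by blast
qed

lemma diff_invert_p: "x \<in> invert_p p W \<Longrightarrow> y \<in> invert_p p W \<Longrightarrow> x - y \<in> invert_p p W"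
proof -
  assume "x \<in> invert_p p W" "y \<in> invert_p p W"
  then obtain m n where mn: "of_nat p ^ m * x \<in> W" "of_nat p ^ n * y \<in> W"
    unfolding invert_p_iff by blast
  have "of_nat p ^ n * (of_nat p ^ m * x) - of_nat p ^ m * (of_nat p ^ n * y) \<in> W"
    by (intro diff_W mult_W[OF power_W[OF of_nat_W]] mn)
  then have "of_nat p ^ (m + n) * (x - y) \<in> W" by (simp add: power_add algebra_simps)
  then show ?thesis unfolding invert_p_iff by blast
qed

lemma add_invert_p: "x \<in> invert_p p W \<Longrightarrow> y \<in> invert_p p W \<Longrightarrow> x + y \<in> invert_p p W"
  using diff_invert_p[of x "0 - y"] diff_invert_p[of 0 y] W_subset_invert_p[OF zero_W] by simp

lemma inverse_invert_p:
  assumes "x \<in> invert_p p W"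
  shows "inverse x \<in> invert_p p W"
proof (cases "x = 0")
  case False
  obtain n where n: "of_nat p ^ n * x \<in> W" using assms unfolding invert_p_iff by blast
  moreover have "of_nat p ^ n * x \<noteq> 0" using False p_nonzero by simp
  ultimately obtain m u where u: "u \<in> W" "of_nat p ^ n * x = of_nat p ^ m * u"
    "\<nexists>y. y \<in> W \<and> u = of_nat p * y" by (rule W_factor)
  have "u \<noteq> 0" using u(3) zero_W by auto
  have "of_nat p ^ m * inverse x = of_nat p ^ n * inverse u"
    using u(2) False \<open>u \<noteq> 0\<close> by (simp add: field_simps)
  moreover have "\<dots> \<in> W" by (intro mult_W power_W of_nat_W inverse_W u)
  ultimately show ?thesis unfolding invert_p_iff by metis
qed (use W_subset_invert_p zero_W in auto)

text \<open>W is the valuation ring of W[1/p]: clear the denominator p^n, then the size of the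
  numerator shows that it is divisible by p^n again.\<close>

lemma invert_p_integral:
  assumes "x \<in> invert_p p W" "vabs x \<le> 1"
  shows "x \<in> W"
proof -
  obtain n where n: "of_nat p ^ n * x \<in> W" using assms unfolding invert_p_iff by blast
  have "vabs (of_nat p ^ n * x) \<le> (1 / real p) ^ n"
    using assms p_gt_1 by (simp add: vabs_p_power mult_left_le)
  then obtain y where "y \<in> W" "of_nat p ^ n * x = of_nat p ^ n * y" using W_divisible n by blast
  then show ?thesis using p_nonzero by simp
qed

lemma vabs_W_le_1:
  assumes "w \<in> W" shows "vabs w \<le> 1"
proof (cases "w = 0")
  case False
  obtain m u where "u \<in> W" "w = of_nat p ^ m * u" "\<nexists>y. y \<in> W \<and> u = of_nat p * y"
    by (rule W_factor[OF assms False])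
  then show ?thesis using vabs_unit p_gt_1 by (simp add: vabs_p_power power_le_one)
qed simp

lemma complete_invert_p: "complete (invert_p p W)"
  unfolding complete_def
proof (intro allI impI)
  fix X assume "(\<forall>n. X n \<in> invert_p p W) \<and> Cauchy X"
  then have X: "\<And>n. X n \<in> invert_p p W" and cauchy: "Cauchy X" by auto
  have pos: "(1 / real p) ^ n > 0" for n using p_gt_1 by simp
  have "\<forall>n. \<exists>N. \<forall>i\<ge>N. \<forall>j\<ge>N. dist (X i) (X j) < (1 / real p) ^ n"
    using cauchy pos unfolding Cauchy_def by blast
  then obtain N where N: "\<And>n i j. i \<ge> N n \<Longrightarrow> j \<ge> N n \<Longrightarrow> vabs (X i - X j) < (1 / real p) ^ n"
    unfolding dist_vabs by metis
  \<comment> \<open>The summand n makes r strictly increasing; the sum makes \<open>r n\<close>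
    exceed every \<open>N m\<close> with m \<le> n.\<close>
  define r where "r = (\<lambda>n. n + (\<Sum>i\<le>n. N i))"
  have r: "strict_mono r" by (intro strict_monoI_Suc) (simp add: r_def)
  have rN: "r n \<ge> N m" if "m \<le> n" for m n
    using member_le_sum[of m "{..n}" N] that by (simp add: r_def trans_le_add2)
  \<comment> \<open>Terms beyond \<open>N 0\<close> differ by less than 1, so subtracting
    \<open>X (r 0)\<close> moves the subsequence into W, where \<open>complete_W\<close>
    applies.\<close>
  define u where "u = (\<lambda>n. X (r n) - X (r 0))"
  have u: "u n \<in> W" for n
    unfolding u_def using N[of 0 "r n" "r 0"] rN[of 0]
    by (intro invert_p_integral diff_invert_p X) auto
  have "\<exists>y\<in>W. u (Suc n) - u n = of_nat p ^ n * y" for n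
    using N[of n "r (Suc n)" "r n"] rN[of n]
    by (intro W_divisible diff_W u) (auto simp: u_def)
  then obtain x where x: "x \<in> W" "\<And>n. \<exists>y\<in>W. x - u n = of_nat p ^ n * y"
    using complete_W[of u] u by blast
  have "vabs (X (r n) - (x + X (r 0))) \<le> (1 / real p) ^ n" for n
  proof -
    obtain y where "y \<in> W" "x - u n = of_nat p ^ n * y" using x by blast
    then have "vabs (x - u n) \<le> (1 / real p) ^ n"
      using p_gt_1 vabs_W_le_1[of y] by (simp add: vabs_p_power mult_left_le)
    then show ?thesis by (simp add: u_def vabs_minus_commute algebra_simps)
  qed
  moreover have "(\<lambda>n. (1 / real p) ^ n) \<longlonglongrightarrow> 0" using p_gt_1 by (intro LIMSEQ_realpow_zero) auto
  ultimately have "(\<lambda>n. vabs (X (r n) - (x + X (r 0)))) \<longlonglongrightarrow> 0"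
    by - (rule Lim_null_comparison[OF always_eventually], simp_all)
  then have "(X \<circ> r) \<longlonglongrightarrow> x + X (r 0)" by (subst tendsto_iff_vabs) (simp add: o_def)
  then have "X \<longlonglongrightarrow> x + X (r 0)" using Cauchy_converges_subseq[OF cauchy r] by blast
  moreover have "x + X (r 0) \<in> invert_p p W" using x X W_subset_invert_p add_invert_p by blast
  ultimately show "\<exists>l\<in>invert_p p W. X \<longlonglongrightarrow> l" by blast
qed

text \<open>If \<open>b\<close> lies outside the closed span \<open>V\<close> of the other generators, at distance \<open>\<delta>\<close> from it, then
  $|v + c b| \ge \delta |c|$, so the coordinates of a Cauchy sequence in \<open>V + L b\<close> are Cauchy.\<close>

lemma complete_span:
  assumes "finite B"
  shows "complete {\<Sum>b\<in>B. c b * b | c. \<forall>b\<in>B. c b \<in> invert_p p W}"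
  using assms
proof (induction B)
  case empty
  show ?case by (simp add: compact_imp_complete)
next
  case (insert b B)
  define V where "V = {\<Sum>b\<in>B. c b * b | c. \<forall>b\<in>B. c b \<in> invert_p p W}"
  define V' where "V' = {\<Sum>b\<in>insert b B. c b * b | c. \<forall>b\<in>insert b B. c b \<in> invert_p p W}"
  have V': "V' = {v + c * b | v c. v \<in> V \<and> c \<in> invert_p p W}"
  proof (intro equalityI subsetI)
    fix x assume "x \<in> V'"
    then obtain c where "x = (\<Sum>b\<in>insert b B. c b * b)" "\<forall>b\<in>insert b B. c b \<in> invert_p p W"
      unfolding V'_def by blast
    then have "x = (\<Sum>b\<in>B. c b * b) + c b * b" "(\<Sum>b\<in>B. c b * b) \<in> V" "c b \<in> invert_p p W"
      using insert.hyps by (auto simp: V_def)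
    then show "x \<in> {v + c * b | v c. v \<in> V \<and> c \<in> invert_p p W}" by blast
  next
    fix x assume "x \<in> {v + c * b | v c. v \<in> V \<and> c \<in> invert_p p W}"
    then obtain v c where x: "x = v + c * b" "v \<in> V" "c \<in> invert_p p W" by blast
    then obtain a where a: "v = (\<Sum>b\<in>B. a b * b)" "\<forall>b\<in>B. a b \<in> invert_p p W"
      unfolding V_def by blast
    have "(\<Sum>x\<in>B. (a(b := c)) x * x) = v"
      unfolding a(1) using insert.hyps by (intro sum.cong) auto
    then have "x = (\<Sum>x\<in>insert b B. (a(b := c)) x * x)"
      using insert.hyps x by simp
    moreover have "\<forall>x\<in>insert b B. (a(b := c)) x \<in> invert_p p W" using a x by simp
    ultimately show "x \<in> V'" unfolding V'_def by blast
  qed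
  have complete_V: "complete V" using insert.IH by (simp add: V_def)
  have V_I: "x \<in> V" if "\<forall>b\<in>B. c b \<in> invert_p p W" "x = (\<Sum>b\<in>B. c b * b)" for c x
    using that by (auto simp: V_def)
  have V_diff: "x - y \<in> V" if x: "x \<in> V" and y: "y \<in> V" for x y
  proof -
    obtain c where c: "x = (\<Sum>b\<in>B. c b * b)" "\<forall>b\<in>B. c b \<in> invert_p p W"
      using x unfolding V_def by blast
    obtain c' where "y = (\<Sum>b\<in>B. c' b * b)" "\<forall>b\<in>B. c' b \<in> invert_p p W"
      using y unfolding V_def by blast
    with c have "x - y = (\<Sum>b\<in>B. (c b - c' b) * b)" "\<forall>b\<in>B. c b - c' b \<in> invert_p p W"
      by (auto simp: sum_subtractf algebra_simps intro: diff_invert_p)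
    then show ?thesis by (intro V_I[of "\<lambda>b. c b - c' b"]) auto
  qed
  have V_scale: "a * x \<in> V" if a: "a \<in> invert_p p W" and x: "x \<in> V" for a x
  proof -
    obtain c where "x = (\<Sum>b\<in>B. c b * b)" "\<forall>b\<in>B. c b \<in> invert_p p W"
      using x unfolding V_def by blast
    then have "a * x = (\<Sum>b\<in>B. (a * c b) * b)" "\<forall>b\<in>B. a * c b \<in> invert_p p W"
      using a by (auto simp: sum_distrib_left mult.assoc intro: mult_invert_p)
    then show ?thesis by (intro V_I[of "\<lambda>b. a * c b"]) auto
  qed
  have V_add: "x + y \<in> V" if "x \<in> V" "y \<in> V" for x y
    using V_diff[OF that(1) V_diff[OF V_diff[OF that(2) that(2)] that(2)]] by simp
  show ?case
  proof (cases "b \<in> V")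
    \<comment> \<open>The generators need not be independent; one that already lies in V adds
      nothing.\<close>
    case True
    have "0 \<in> invert_p p W" using zero_W W_subset_invert_p by blast
    then have "V' = V" unfolding V' using True V_add V_scale by force
    then show ?thesis using complete_V by (simp add: V'_def)
  next
    case False
    \<comment> \<open>By the induction hypothesis V is complete, hence closed, so b has a positive
      distance from it.\<close>
    have "open (- V)" using complete_imp_closed[OF complete_V] by auto
    then obtain \<delta> where \<delta>: "\<delta> > 0" "\<And>v. v \<in> V \<Longrightarrow> vabs (v - b) \<ge> \<delta>"
      using False unfolding open_dist dist_vabs by (meson ComplD ComplI not_le)
    have bound: "vabs c * \<delta> \<le> vabs (v + c * b)" if "v \<in> V" "c \<in> invert_p p W" for v c
    proof (cases "c = 0")
      case False
      have "(0 - inverse c) * v \<in> V"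
        by (intro V_scale diff_invert_p inverse_invert_p W_subset_invert_p zero_W that)
      then have "\<delta> \<le> vabs ((0 - inverse c) * v - b)" by (rule \<delta>(2))
      then have "vabs c * \<delta> \<le> vabs (c * ((0 - inverse c) * v - b))"
        by (simp add: vabs_mult mult_left_mono)
      also have "c * ((0 - inverse c) * v - b) = - (v + c * b)" using False by (simp add: field_simps)
      finally show ?thesis by (simp only: vabs_minus)
    qed simp
    have "complete V'"
      unfolding complete_def
    proof (intro allI impI)
      fix X assume "(\<forall>n. X n \<in> V') \<and> Cauchy X"
      then have X: "\<forall>n. \<exists>v c. v \<in> V \<and> c \<in> invert_p p W \<and> X n = v + c * b" and cauchy: "Cauchy X"
        unfolding V' by blast+
      then obtain v c where v: "\<And>n. v n \<in> V" and c: "\<And>n. c n \<in> invert_p p W"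
        and Xn: "\<And>n. X n = v n + c n * b" by metis
      have "Cauchy c"
      proof (rule metric_CauchyI)
        fix e :: real assume e: "e > 0"
        then obtain M where M: "\<And>m n. m \<ge> M \<Longrightarrow> n \<ge> M \<Longrightarrow> dist (X m) (X n) < e * \<delta>"
          using metric_CauchyD[OF cauchy, of "e * \<delta>"] \<delta> by auto
        have "dist (c m) (c n) < e" if "m \<ge> M" "n \<ge> M" for m n
        proof -
          have "vabs (c m - c n) * \<delta> \<le> vabs ((v m - v n) + (c m - c n) * b)"
            by (intro bound V_diff v diff_invert_p c)
          also have "\<dots> = dist (X m) (X n)" by (simp add: dist_vabs Xn algebra_simps)
          also have "\<dots> < e * \<delta>" using M that by blast
          finally show ?thesis using \<delta> by (simp add: dist_vabs)
        qed
        then show "\<exists>M. \<forall>m\<ge>M. \<forall>n\<ge>M. dist (c m) (c n) < e" by blast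
      qed
      then obtain c' where c': "c' \<in> invert_p p W" "c \<longlonglongrightarrow> c'"
        using completeE[OF complete_invert_p, of c] c by blast
      have cb: "(\<lambda>n. c n * b) \<longlonglongrightarrow> c' * b"
      proof -
        have "(\<lambda>n. vabs (c n - c') * vabs b) \<longlonglongrightarrow> 0"
          using c'(2) by (intro tendsto_mult_left_zero) (simp add: tendsto_iff_vabs)
        then show ?thesis
          by (subst tendsto_iff_vabs) (simp add: vabs_mult flip: left_diff_distrib)
      qed
      have "Cauchy v"
      proof (rule metric_CauchyI)
        fix e :: real assume e: "e > 0"
        obtain M where M: "\<And>m n. m \<ge> M \<Longrightarrow> n \<ge> M \<Longrightarrow> dist (X m) (X n) < e"
          using metric_CauchyD[OF cauchy e] by auto
        obtain M' where M': "\<And>m n. m \<ge> M' \<Longrightarrow> n \<ge> M' \<Longrightarrow> dist (c m * b) (c n * b) < e"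
          using metric_CauchyD[OF LIMSEQ_imp_Cauchy[OF cb] e] by auto
        have "dist (v m) (v n) < e" if "m \<ge> max M M'" "n \<ge> max M M'" for m n
        proof -
          have "v m - v n = (X m - X n) - (c m * b - c n * b)" by (simp add: Xn)
          then have "vabs (v m - v n) \<le> max (vabs (X m - X n)) (vabs (c m * b - c n * b))"
            by (metis vabs_diff)
          also have "\<dots> < e" using M M' that by (simp add: dist_vabs)
          finally show ?thesis by (simp add: dist_vabs)
        qed
        then show "\<exists>M. \<forall>m\<ge>M. \<forall>n\<ge>M. dist (v m) (v n) < e" by blast
      qed
      then obtain v' where v': "v' \<in> V" "v \<longlonglongrightarrow> v'"
        using completeE[OF complete_V, of v] v by blast
      have "(\<lambda>n. max (vabs (v n - v')) (vabs (c n * b - c' * b))) \<longlonglongrightarrow> max 0 0"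
        using v'(2) cb by (intro tendsto_max) (simp_all add: tendsto_iff_vabs)
      moreover have "vabs (X n - (v' + c' * b)) \<le> max (vabs (v n - v')) (vabs (c n * b - c' * b))"
        for n
        using vabs_add[of "v n - v'" "c n * b - c' * b"] by (simp add: Xn algebra_simps)
      ultimately have "(\<lambda>n. vabs (X n - (v' + c' * b))) \<longlonglongrightarrow> 0"
        by - (rule Lim_null_comparison[OF always_eventually], simp_all)
      then have "X \<longlonglongrightarrow> v' + c' * b" by (simp add: tendsto_iff_vabs)
      moreover have "v' + c' * b \<in> V'" unfolding V' using v' c' by blast
      ultimately show "\<exists>l\<in>V'. X \<longlonglongrightarrow> l" by blast
    qed
    then show ?thesis by (simp add: V'_def)
  qed
qed

lemma complete_UNIV_K: "complete (UNIV :: 'a set)"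
proof -
  obtain B where B: "finite B"
    "\<And>x. \<exists>c. (\<forall>b\<in>B. c b \<in> invert_p p W) \<and> x = (\<Sum>b\<in>B. c b * b)"
    using finite_ext by blast
  have "x \<in> {\<Sum>b\<in>B. c b * b | c. \<forall>b\<in>B. c b \<in> invert_p p W}" for x using B(2)[of x] by blast
  then have "{\<Sum>b\<in>B. c b * b | c. \<forall>b\<in>B. c b \<in> invert_p p W} = UNIV" by blast
  then show ?thesis using complete_span[OF B(1)] by simp
qed

end

section \<open>Eigenvectors of formal substitution\<close>

text \<open>The coefficient of degree n \<ge> 2 in l(s) = s_1 l contains l_n only through l_n s_1^n
  on the left and s_1 l_n on the right; solving for l_n gives the recursion. The value 1 in degree 1
  is a normalisation. This is the Koenigs linearisation of s at 0.\<close>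

fun formal_log_coeff :: "'a::field fps \<Rightarrow> nat \<Rightarrow> 'a" where
  "formal_log_coeff s n = (if n = 0 then 0 else if n = 1 then 1
     else (\<Sum>k<n. formal_log_coeff s k * fps_nth (s ^ k) n) / (fps_nth s 1 - fps_nth s 1 ^ n))"

declare formal_log_coeff.simps [simp del]

definition formal_log :: "'a::field fps \<Rightarrow> 'a fps" where
  "formal_log s = Abs_fps (formal_log_coeff s)"

lemma formal_log_nth_0 [simp]: "fps_nth (formal_log s) 0 = 0"
  by (simp add: formal_log_def formal_log_coeff.simps)

lemma formal_log_nth_1 [simp]: "fps_nth (formal_log s) (Suc 0) = 1"
  by (simp add: formal_log_def formal_log_coeff.simps)

lemma subdegree_formal_log [simp]: "subdegree (formal_log s) = 1"
  by (rule subdegreeI) (auto simp: less_Suc_eq)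

lemma formal_log_compose:
  fixes s :: "'a::field fps"
  assumes s0: "fps_nth s 0 = 0" and s1: "\<And>n. n \<ge> 2 \<Longrightarrow> fps_nth s 1 ^ n \<noteq> fps_nth s 1"
  shows "formal_log s oo s = fps_const (fps_nth s 1) * formal_log s"
proof (rule fps_ext)
  fix n
  have split: "fps_nth (formal_log s oo s) n
      = (\<Sum>k<n. formal_log_coeff s k * fps_nth (s ^ k) n) + formal_log_coeff s n * fps_nth s 1 ^ n"
    using startsby_zero_power_nth_same[OF s0, of n]
    by (simp add: fps_compose_nth formal_log_def atLeast0AtMost lessThan_Suc_atMost[symmetric])
  consider "n = 0" | "n = 1" | "n \<ge> 2" by linarith
  then show "fps_nth (formal_log s oo s) n
      = fps_nth (fps_const (fps_nth s 1) * formal_log s) n"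
  proof cases
    case 3
    then have "formal_log_coeff s n * (fps_nth s 1 - fps_nth s 1 ^ n)
        = (\<Sum>k<n. formal_log_coeff s k * fps_nth (s ^ k) n)"
      using s1[OF 3] by (subst formal_log_coeff.simps) simp
    then show ?thesis unfolding split by (simp add: formal_log_def algebra_simps)
  qed (use split in \<open>simp_all add: formal_log_def formal_log_coeff.simps\<close>)
qed

text \<open>In degree 0 the equation reads \<open>H 0 = \<mu> * H 0\<close>, so \<mu> \<noteq> 1
  forces H to vanish at 0. Orders of vanishing multiply under composition, so ord H * ord s = ord H
  gives ord s = 1, and the lowest coefficients can be compared.\<close>

lemma eigenseries_eigenvalue:
  fixes s H :: "'a::field fps"
  assumes s: "fps_nth s 0 = 0" "s \<noteq> 0" and H: "H \<noteq> 0"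
    and eigen: "H oo s = fps_const \<mu> * H" and \<mu>: "\<mu> \<noteq> 1"
  shows "subdegree H \<ge> 1" "fps_nth s 1 \<noteq> 0" "\<mu> = fps_nth s 1 ^ subdegree H"
proof -
  define j where "j = subdegree H"
  have Hj: "fps_nth H j \<noteq> 0" using H by (simp add: j_def)
  have "j \<noteq> 0"
  proof
    assume "j = 0"
    moreover have "fps_nth H 0 = \<mu> * fps_nth H 0"
      using arg_cong[OF eigen, of "\<lambda>f. fps_nth f 0"] by simp
    ultimately show False using Hj \<mu> by simp
  qed
  then show "subdegree H \<ge> 1" by (simp add: j_def)
  have "H oo s \<noteq> 0" using s H by (simp add: fps_compose_eq_0_iff)
  then have "\<mu> \<noteq> 0" using eigen by auto
  then have "subdegree (fps_const \<mu> * H) = j" using H by (simp add: j_def)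
  then have "j * subdegree s = j" using eigen s by (metis j_def subdegree_fps_compose)
  then have sub: "subdegree s = 1" using \<open>j \<noteq> 0\<close> by simp
  then show "fps_nth s 1 \<noteq> 0" using s by (metis nth_subdegree_nonzero)
  have "\<mu> * fps_nth H j = fps_nth (H oo s) j" by (simp add: eigen)
  also have "\<dots> = (\<Sum>i\<in>{0..j}. fps_nth H i * fps_nth (s ^ i) j)" by (simp add: fps_compose_nth)
  also have "\<dots> = (\<Sum>i\<in>{j}. fps_nth H i * fps_nth (s ^ i) j)"
    by (rule sum.mono_neutral_right) (auto simp: j_def intro: nth_less_subdegree_zero)
  also have "\<dots> = fps_nth H j * fps_nth s 1 ^ j"
    using startsby_zero_power_nth_same[OF s(1)] by simp
  finally show "\<mu> = fps_nth s 1 ^ subdegree H" using Hj by (simp add: j_def)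
qed

text \<open>The scalar is chosen so that the difference D vanishes through degree k. If nonzero, D
  would be an eigenseries with the same eigenvalue but larger order, which makes a positive power of
  s_1 equal to 1.\<close>

lemma eigenseries_unique:
  fixes s H :: "'a::field fps"
  assumes s: "fps_nth s 0 = 0" "fps_nth s 1 \<noteq> 0" and s1: "\<And>n. n \<ge> 1 \<Longrightarrow> fps_nth s 1 ^ n \<noteq> 1"
    and H: "H \<noteq> 0" and k: "subdegree H = k" "k \<ge> 1"
    and eigen: "H oo s = fps_const (fps_nth s 1 ^ k) * H"
  shows "H = fps_const (fps_nth H k) * formal_log s ^ k"
proof (rule ccontr)
  define D where "D = H - fps_const (fps_nth H k) * formal_log s ^ k"
  assume "H \<noteq> fps_const (fps_nth H k) * formal_log s ^ k"
  then have D: "D \<noteq> 0" by (simp add: D_def)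
  have "formal_log s oo s = fps_const (fps_nth s 1) * formal_log s"
  proof (rule formal_log_compose[OF s(1)])
    fix n :: nat assume "n \<ge> 2"
    then show "fps_nth s 1 ^ n \<noteq> fps_nth s 1"
      using s1[of "n - 1"] s(2) power_Suc[of "fps_nth s 1" "n - 1"] by auto
  qed
  then have "formal_log s ^ k oo s = fps_const (fps_nth s 1 ^ k) * formal_log s ^ k"
    by (simp add: power_mult_distrib flip: fps_compose_power[OF s(1)] fps_const_power)
  then have "D oo s = fps_const (fps_nth s 1 ^ k) * D"
    unfolding D_def fps_compose_sub_distrib fps_compose_mult_distrib[OF s(1)] eigen
    by (simp add: algebra_simps)
  then have eq: "fps_nth s 1 ^ k = fps_nth s 1 ^ subdegree D"
    using eigenseries_eigenvalue(3)[OF s(1) _ D] s s1[OF k(2)] by fastforce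
  have logk: "subdegree (formal_log s ^ k) = k" "fps_nth (formal_log s ^ k) k = 1"
    using startsby_zero_power_nth_same[OF formal_log_nth_0, of s k] by simp_all
  have H_low: "fps_nth H i = 0" if "i < k" for i
    using that k(1) by (intro nth_less_subdegree_zero) simp
  have log_low: "fps_nth (formal_log s ^ k) i = 0" if "i < k" for i
    using startsby_zero_power_prefix[OF formal_log_nth_0] that by blast
  have "fps_nth D i = 0" if "i \<le> k" for i
    using that H_low[of i] log_low[of i] logk(2) by (cases "i = k") (simp_all add: D_def)
  then have "subdegree D > k" using nth_subdegree_nonzero[OF D] by (meson not_le)
  then have "fps_nth s 1 ^ subdegree D = fps_nth s 1 ^ k * fps_nth s 1 ^ (subdegree D - k)"
    by (simp flip: power_add)
  then show False using eq s s1[of "subdegree D - k"] \<open>subdegree D > k\<close> by simp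
qed

section \<open>Iterates of s and the infinite product for the logarithm\<close>

lemma iter_series_nth_0: "fps_nth s 0 = 0 \<Longrightarrow> fps_nth (iter_series s i) 0 = 0"
  by (cases i) (simp_all add: iter_series_def)

lemma iter_series_Suc: "iter_series s (Suc i) = s oo iter_series s i"
  by (simp add: iter_series_def)

text \<open>The i-th factor is the quotient of the (i+1)-st iterate by s_1 times the i-th
  one.\<close>

lemma log_product_telescope:
  assumes s: "fps_nth s 0 = 0" "fps_nth s 1 \<noteq> 0"
  shows "fps_const (fps_nth s 1 ^ N) * (fps_X * (\<Prod>i<N. ratio_series s oo iter_series s i))
    = iter_series s N"
proof (induction N)
  case 0
  show ?case by (simp add: iter_series_def)
next
  case (Suc N)
  define g where "g = fps_const (fps_nth s 1) * fps_X"
  have "subdegree s = 1" using s by (intro subdegreeI) (auto simp: less_Suc_eq)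
  \<comment> \<open>Exact divisibility makes the formal quotient in \<open>ratio_series\<close>
    compatible with composition.\<close>
  then have "g dvd s" using s by (subst fps_dvd_iff) (auto simp: g_def)
  then have "s oo iter_series s N
      = (s / g oo iter_series s N) * (g oo iter_series s N)"
    using iter_series_nth_0[OF s(1)] by (rule fps_compose_divide)
  also have "g oo iter_series s N = fps_const (fps_nth s 1) * iter_series s N"
    unfolding g_def using iter_series_nth_0[OF s(1)] by (simp add: fps_compose_mult_distrib)
  also have "s / g = ratio_series s" by (simp add: ratio_series_def g_def)
  finally show ?case
    by (simp add: iter_series_Suc flip: Suc.IH fps_const_mult)
qed

text \<open>By conjugation with the formal logarithm \<open>\<ell>\<close>, the \<open>N\<close>-th iterate of \<open>s\<close> is
  $\ell^{-1}(s_1^N \ell)$; hence the partial products, which telescope to $s_1^{-N} s^{\circ N}$, tend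
  to \<open>\<ell>\<close>.\<close>

lemma log_series_eq:
  fixes s :: "'a::nonarch_field fps"
  assumes s: "fps_nth s 0 = 0" "fps_nth s 1 \<noteq> 0" and small: "vabs (fps_nth s 1) < 1"
  shows "log_series s = formal_log s"
proof (rule fps_ext)
  fix n
  define l where "l = formal_log s"
  define t where "t = fps_inv l"
  define c where "c = fps_nth s 1"
  have l: "fps_nth l 0 = 0" "fps_nth l 1 \<noteq> 0" by (simp_all add: l_def)
  have c_pow: "c ^ n \<noteq> c" if "n \<ge> 2" for n
  proof
    assume "c ^ n = c"
    then have "c * c ^ (n - 1) = c" using that by (metis power_eq_if not_numeral_le_zero)
    then have "vabs c ^ (n - 1) = 1" using s(2) by (simp add: c_def flip: vabs_power)
    moreover have "vabs c ^ (n - 1) \<le> vabs c ^ 1"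
      using that small by (intro power_decreasing) (auto simp: c_def)
    ultimately show False using small by (simp add: c_def)
  qed
  have l_s: "l oo s = fps_const c * l"
    using formal_log_compose[OF s(1)] c_pow by (simp add: l_def c_def)
  have l_iter: "l oo iter_series s N = fps_const (c ^ N) * l" for N
  proof (induction N)
    case (Suc N)
    have "l oo iter_series s (Suc N) = (l oo s) oo iter_series s N"
      using s by (simp add: iter_series_Suc iter_series_nth_0 fps_compose_assoc)
    also have "\<dots> = fps_const c * (l oo iter_series s N)"
      using s by (simp add: l_s iter_series_nth_0 fps_compose_mult_distrib)
    finally show ?case using Suc by (simp add: mult.assoc flip: fps_const_mult)
  qed (simp add: iter_series_def)
  have t: "t oo l = fps_X" unfolding t_def by (rule fps_inv[OF l])
  have t0: "fps_nth t 0 = 0" by (simp add: t_def fps_inv_def)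
  have t1: "fps_nth t 1 = 1"
    using arg_cong[OF t, of "\<lambda>f. fps_nth f 1"] by (simp add: fps_compose_nth t0 l_def)
  have iter: "iter_series s N = t oo (fps_const (c ^ N) * l)" for N
  proof -
    have "iter_series s N = (t oo l) oo iter_series s N"
      using s by (simp add: t iter_series_nth_0)
    also have "\<dots> = t oo (fps_const (c ^ N) * l)"
      using s l by (simp add: iter_series_nth_0 l_iter flip: fps_compose_assoc)
    finally show ?thesis .
  qed
  define P where "P = (\<lambda>N. fps_nth (fps_X * (\<Prod>i<N. ratio_series s oo iter_series s i)) n)"
  \<comment> \<open>A bound for all coefficients of the expansion in powers of c^N, independent of
    N.\<close>
  define B where "B = (\<Sum>i\<le>n. vabs (fps_nth t i * fps_nth (l ^ i) n))"
  have "vabs (P N - fps_nth l n) \<le> vabs c ^ N * B" for N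
  proof -
    have c_nz: "c ^ N \<noteq> 0" using s by (simp add: c_def)
    define a where "a = (\<lambda>i. fps_nth t i * fps_nth (l ^ i) n)"
    have "c ^ N * P N = fps_nth (t oo (fps_const (c ^ N) * l)) n"
      using arg_cong[OF log_product_telescope[OF s, of N], of "\<lambda>f. fps_nth f n"]
      by (simp add: P_def iter c_def)
    also have "\<dots> = (\<Sum>i\<le>n. (c ^ N) ^ i * a i)"
      by (simp add: fps_compose_nth power_mult_distrib atLeast0AtMost a_def mult.left_commute)
    finally have "c ^ N * (P N - fps_nth l n) = (\<Sum>i\<le>n. (c ^ N) ^ i * a i) - c ^ N * fps_nth l n"
      by (simp add: algebra_simps)
    also have "c ^ N * fps_nth l n = (\<Sum>i\<le>n. if i = 1 then (c ^ N) ^ i * a i else 0)"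
      using l t1 by (cases n) (simp_all add: a_def)
    also have "(\<Sum>i\<le>n. (c ^ N) ^ i * a i) - (\<Sum>i\<le>n. if i = 1 then (c ^ N) ^ i * a i else 0)
        = (\<Sum>i\<le>n. if i = 1 then 0 else (c ^ N) ^ i * a i)"
      unfolding sum_subtractf[symmetric] by (rule sum.cong) auto
    finally have *: "c ^ N * (P N - fps_nth l n) = (\<Sum>i\<le>n. if i = 1 then 0 else (c ^ N) ^ i * a i)" .
    \<comment> \<open>The term i = 1 has cancelled against the limit and the term i = 0 is 0, as t
      has no constant term. All others carry (c^N)^2, so one factor c^N is left after division and
      tends to 0.\<close>
    have "vabs (c ^ N * (P N - fps_nth l n)) \<le> vabs (c ^ N) * (vabs c ^ N * B)"
      unfolding *
    proof (rule vabs_sum_le)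
      have B: "vabs (a i) \<le> B" if "i \<le> n" for i
        using member_le_sum[of i "{..n}" "\<lambda>i. vabs (a i)"] that by (simp add: B_def a_def)
      show "0 \<le> vabs (c ^ N) * (vabs c ^ N * B)" by (simp add: B_def sum_nonneg)
      fix i assume i: "i \<in> {..n}"
      show "vabs (if i = 1 then 0 else (c ^ N) ^ i * a i) \<le> vabs (c ^ N) * (vabs c ^ N * B)"
      proof (cases "i \<ge> 2")
        case True
        have "(vabs c ^ N) ^ i \<le> (vabs c ^ N) ^ 2"
          using True small by (intro power_decreasing) (auto simp: c_def power_le_one)
        then have "(vabs c ^ N) ^ i * vabs (a i) \<le> (vabs c ^ N) ^ 2 * B"
          using B i by (intro mult_mono) auto
        then show ?thesis using True by (simp add: vabs_mult vabs_power power2_eq_square)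
      next
        case False
        then have "i = 0 \<or> i = 1" by auto
        then show ?thesis using t0 by (auto simp: a_def B_def sum_nonneg)
      qed
    qed
    then show ?thesis using c_nz by (simp add: vabs_mult)
  qed
  moreover have "(\<lambda>N. vabs c ^ N * B) \<longlonglongrightarrow> 0"
    using small by (intro tendsto_mult_left_zero LIMSEQ_realpow_zero) (auto simp: c_def)
  ultimately have "(\<lambda>N. vabs (P N - fps_nth l n)) \<longlonglongrightarrow> 0"
    by - (rule Lim_null_comparison[OF always_eventually], simp_all)
  then have "P \<longlonglongrightarrow> fps_nth l n" by (simp add: tendsto_iff_vabs)
  then show "fps_nth (log_series s) n = fps_nth (formal_log s) n"
    by (simp add: log_series_def P_def l_def limI)
qed

section \<open>Substitution on an annulus\<close>

text \<open>Submultiplicativity of the Gauss norm of radius \<rho>, stated coefficientwise. A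
  coefficient of a product of formal Laurent series is a finite sum, so the ultrametric inequality
  suffices.\<close>

lemma fls_mult_weighted_bound:
  fixes f g :: "'a::nonarch_field fls"
  assumes \<rho>: "\<rho> > 0" and f: "\<And>i. vabs (fls_nth f i) * \<rho> powi i \<le> A"
    and g: "\<And>i. vabs (fls_nth g i) * \<rho> powi i \<le> B"
  shows "vabs (fls_nth (f * g) n) * \<rho> powi n \<le> A * B"
proof -
  have pos: "\<rho> powi i > 0" for i using \<rho> by simp
  have "0 \<le> vabs (fls_nth f 0) * \<rho> powi 0" "0 \<le> vabs (fls_nth g 0) * \<rho> powi 0" by simp_all
  then have AB: "0 \<le> A" "0 \<le> B" using f g by (blast intro: order_trans)+
  have "vabs (fls_nth (f * g) n) \<le> A * B / \<rho> powi n"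
    unfolding fls_times_nth(2)
  proof (rule vabs_sum_le)
    fix i
    have "vabs (fls_nth f i) * \<rho> powi i * (vabs (fls_nth g (n - i)) * \<rho> powi (n - i)) \<le> A * B"
      using AB \<rho> by (intro mult_mono f g mult_nonneg_nonneg) simp_all
    moreover have "\<rho> powi n = \<rho> powi i * \<rho> powi (n - i)"
      using \<rho> by (simp flip: power_int_add)
    ultimately show "vabs (fls_nth f i * fls_nth g (n - i)) \<le> A * B / \<rho> powi n"
      using pos[of n] by (simp add: pos_le_divide_eq vabs_mult ac_simps)
  qed (use AB pos[of n] in auto)
  then show ?thesis using pos[of n] by (simp add: pos_le_divide_eq)
qed

lemma fls_power_weighted_bound:
  fixes f :: "'a::nonarch_field fls"
  assumes "\<rho> > 0" "\<And>i. vabs (fls_nth f i) * \<rho> powi i \<le> A"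
  shows "vabs (fls_nth (f ^ j) n) * \<rho> powi n \<le> A ^ j"
proof (induction j arbitrary: n)
  case (Suc j)
  then show ?case using fls_mult_weighted_bound[OF assms(1) assms(2) Suc] by simp
qed simp

section \<open>Binomial expansion of integer powers of 1 + g\<close>

lemma has_sum_finite_support:
  fixes f :: "'b \<Rightarrow> 'c::{comm_monoid_add, topological_space}"
  assumes "finite F" "\<And>x. x \<notin> F \<Longrightarrow> f x = 0"
  shows "(f has_sum sum f F) UNIV"
proof -
  have "(f has_sum sum f F) F \<longleftrightarrow> (f has_sum sum f F) UNIV"
    using assms by (intro has_sum_cong_neutral) auto
  then show ?thesis using assms(1) by simp
qed

lemma binomial_coeff_nat:
  fixes g :: "'a::nonarch_field fls"
  shows "binomial_coeff g (int n) m = fls_nth ((1 + g) ^ n) m"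
proof -
  let ?f = "\<lambda>j. (of_int (int n) gchoose j) * fls_nth (g ^ j) m"
  have "(?f has_sum (sum ?f {..n})) UNIV"
    by (rule has_sum_finite_support) (auto simp flip: binomial_gbinomial)
  then have "binomial_coeff g (int n) m = sum ?f {..n}"
    unfolding binomial_coeff_def by (rule infsumI)
  also have "\<dots> = (\<Sum>j\<le>n. fls_nth (of_nat (n choose j) * g ^ j) m)"
    by (intro sum.cong) (simp_all add: binomial_gbinomial fls_of_nat)
  also have "\<dots> = fls_nth ((1 + g) ^ n) m"
    by (simp add: binomial_ring[of g 1 n] add.commute[of 1 g] fls_nth_sum)
  finally show ?thesis .
qed

lemma height_rem_nth:
  fixes s :: "'a::nonarch_field fps"
  assumes "fps_nth s d \<noteq> 0"
  shows "fls_nth (height_rem d s) i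
    = (if i = 0 \<or> i < - int d then 0 else fps_nth s (nat (i + int d)) / fps_nth s d)"
  using assms by (cases "i = 0") (auto simp: height_rem_def divide_inverse)

text \<open>For n \<ge> 0 the binomial series is finite and s_d^n X^(dn) (1 + g)^n is s^n itself.
  Through this, \<phi> becomes ordinary substitution on nonnegative powers of X.\<close>

lemma binomial_coeff_height_rem:
  fixes s :: "'a::nonarch_field fps"
  assumes "fps_nth s d \<noteq> 0"
  shows "fps_nth s d ^ n * binomial_coeff (height_rem d s) (int n) (m - int d * int n)
    = fls_nth (fps_to_fls (s ^ n)) m"
proof -
  have "(1 + height_rem d s) ^ n
      = fls_shift (int n * int d) (fps_to_fls ((fps_const (inverse (fps_nth s d)) * s) ^ n))"
    by (simp add: height_rem_def fls_shifted_pow fps_to_fls_power)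
  then have "binomial_coeff (height_rem d s) (int n) (m - int d * int n)
      = fls_nth (fps_to_fls (fps_const (inverse (fps_nth s d) ^ n) * s ^ n)) m"
    by (simp add: binomial_coeff_nat power_mult_distrib mult.commute)
  then show ?thesis using assms by (simp flip: power_mult_distrib mult.assoc)
qed

text \<open>The bound \<rho>, rather than a constant below 1, covers the endpoint \<rho> = 1 as
  well: the j-th binomial term has norm at most \<rho>^j, which tends to 0 for \<rho> < 1 and is 1
  for \<rho> = 1.\<close>

locale contracting_rem =
  fixes g :: "'a::nonarch_field fls" and \<rho>\<^sub>0 :: real
  assumes \<rho>0: "0 < \<rho>\<^sub>0" "\<rho>\<^sub>0 < 1"
    and contracting: "\<rho>\<^sub>0 \<le> \<rho> \<Longrightarrow> \<rho> \<le> 1 \<Longrightarrow> vabs (fls_nth g i) * \<rho> powi i \<le> \<rho>"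
begin

lemma binomial_term_bound:
  assumes "\<rho>\<^sub>0 \<le> \<rho>" "\<rho> \<le> 1"
  shows "vabs ((of_int n gchoose j) * fls_nth (g ^ j) m) * \<rho> powi m \<le> \<rho> ^ j"
proof -
  have "vabs (fls_nth (g ^ j) m) * \<rho> powi m \<le> \<rho> ^ j"
    using assms \<rho>0 contracting by (intro fls_power_weighted_bound) auto
  moreover have "vabs (of_int n gchoose j :: 'a) * (vabs (fls_nth (g ^ j) m) * \<rho> powi m)
      \<le> 1 * (vabs (fls_nth (g ^ j) m) * \<rho> powi m)"
    using assms \<rho>0 by (intro mult_right_mono vabs_gbinomial) auto
  ultimately show ?thesis by (simp add: vabs_mult mult.assoc)
qed

lemma binomial_coeff_bound:
  assumes "\<rho>\<^sub>0 \<le> \<rho>" "\<rho> \<le> 1"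
  shows "vabs (binomial_coeff g n m) * \<rho> powi m \<le> 1"
proof -
  have pos: "\<rho> powi m > 0" "\<rho> \<ge> 0" using assms \<rho>0 by auto
  have "vabs (binomial_coeff g n m) \<le> 1 / \<rho> powi m"
    unfolding binomial_coeff_def
  proof (rule infsum_vabs_le)
    fix j
    have "\<rho> ^ j \<le> 1" using pos assms by (simp add: power_le_one)
    then show "vabs ((of_int n gchoose j) * fls_nth (g ^ j) m) \<le> 1 / \<rho> powi m"
      using binomial_term_bound[OF assms, of n j m] pos by (simp add: pos_le_divide_eq)
  qed (use pos in simp)
  then show ?thesis using pos by (simp add: pos_le_divide_eq)
qed

text \<open>Modulo the maximal ideal g has only positive powers of X, so (1 + g)^n reduces to 1 +
  O(X). Concretely, \<open>\<rho>\<^sub>0\<close> to the power m \<le> 0 is at least 1, so the j-th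
  term is at most \<open>\<rho>\<^sub>0 ^ j\<close>, and only j = 0 can reach size 1.\<close>

lemma binomial_coeff_diff_less:
  assumes complete: "complete (UNIV :: 'a set)" and m: "m \<le> 0"
  shows "vabs (binomial_coeff g n m - (if m = 0 then 1 else 0)) < 1"
proof -
  let ?f = "\<lambda>j. (of_int n gchoose j) * fls_nth (g ^ j) m"
  have ge: "\<rho>\<^sub>0 powi m \<ge> 1"
    using m \<rho>0 power_int_decreasing[of m 0 "\<rho>\<^sub>0"] by simp
  have f: "vabs (?f j) \<le> \<rho>\<^sub>0 ^ j" for j
    using binomial_term_bound[of "\<rho>\<^sub>0" n j m] \<rho>0 ge mult_left_mono[OF ge, of "vabs (?f j)"] by simp
  have "?f summable_on UNIV"
  proof (rule nonarch_summable_on[OF complete])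
    fix e :: real assume "e > 0"
    moreover have "(\<lambda>j. \<rho>\<^sub>0 ^ j) \<longlonglongrightarrow> 0" using \<rho>0 by (intro LIMSEQ_realpow_zero) auto
    ultimately obtain J where J: "\<And>j. j \<ge> J \<Longrightarrow> \<rho>\<^sub>0 ^ j < e"
      by (metis eventually_sequentially order_tendstoD(2))
    have "{j \<in> UNIV. vabs (?f j) \<ge> e} \<subseteq> {..<J}"
    proof
      fix j assume "j \<in> {j \<in> UNIV. vabs (?f j) \<ge> e}"
      then have "e \<le> \<rho>\<^sub>0 ^ j" using f[of j] by simp
      then show "j \<in> {..<J}" using J[of j] by (auto simp: not_less[symmetric])
    qed
    then show "finite {j \<in> UNIV. vabs (?f j) \<ge> e}" by (rule finite_subset) simp
  qed
  then have "(?f has_sum binomial_coeff g n m) UNIV"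
    unfolding binomial_coeff_def by (rule has_sum_infsum)
  then have "vabs (binomial_coeff g n m - ?f 0) < 1"
  proof (rule has_sum_vabs_diff_less)
    fix j :: nat assume "j \<in> UNIV - {0}"
    then have "\<rho>\<^sub>0 ^ j \<le> \<rho>\<^sub>0 ^ 1" using \<rho>0 by (intro power_decreasing) auto
    then show "vabs (?f j) < 1" using f[of j] \<rho>0 by simp
  qed simp_all
  then show ?thesis by simp
qed

end

lemma finite_height_contracting:
  fixes s :: "'a::nonarch_field fps"
  assumes "finite_height d s"
  obtains \<rho>\<^sub>0 where "contracting_rem (height_rem d s) \<rho>\<^sub>0"
proof -
  let ?g = "height_rem d s"
  have d: "d \<ge> 2" and s0: "fps_nth s 0 = 0" and s_le: "vabs (fps_nth s i) \<le> 1"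
    and s_less: "i \<in> {1..<d} \<Longrightarrow> vabs (fps_nth s i) < 1" and sd: "vabs (fps_nth s d) = 1" for i
    using assms by (auto simp: finite_height_def)
  have nz: "fps_nth s d \<noteq> 0" using sd by auto
  note g = height_rem_nth[OF nz]
  have g_le: "vabs (fls_nth ?g i) \<le> 1" for i using s_le sd by (simp add: g vabs_divide)
  have g_less: "vabs (fls_nth ?g i) < 1" if "i \<le> 0" for i
  proof (cases "i = 0 \<or> i \<le> - int d")
    case True
    then show ?thesis using s0 by (auto simp: g)
  next
    case False
    then have "nat (i + int d) \<in> {1..<d}" using that by auto
    then show ?thesis using s_less sd by (simp add: g vabs_divide)
  qed
  define c where "c = Max ((\<lambda>i. vabs (fls_nth ?g i)) ` {- int d..0})"
  have c_less: "c < 1" unfolding c_def using g_less by (subst Max_less_iff) auto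
  have c_ge: "vabs (fls_nth ?g i) \<le> c" if "i \<in> {- int d..0}" for i
    unfolding c_def using that by (intro Max_ge) auto
  have c0: "c \<ge> 0" using c_ge[of 0] vabs_nonneg by (rule order_trans[rotated]) simp
  \<comment> \<open>The root yields c \<le> \<rho>^(d+1) for \<rho> \<ge>
    \<open>\<rho>\<^sub>0\<close>, enough to absorb the worst weight \<rho>^(-d) and leave one
    factor \<rho>. The 1/2 keeps the radius positive when c = 0.\<close>
  define \<rho>\<^sub>0 where "\<rho>\<^sub>0 = max (1 / 2) (root (Suc d) c)"
  have \<rho>0: "0 < \<rho>\<^sub>0" "\<rho>\<^sub>0 < 1"
    using c_less real_root_less_mono[of "Suc d" c 1] by (simp_all add: \<rho>\<^sub>0_def)
  have "c = root (Suc d) c ^ Suc d" using c0 by (simp only: real_root_pow_pos2)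
  also have "\<dots> \<le> \<rho>\<^sub>0 ^ Suc d"
    using c0 by (intro power_mono) (simp_all add: \<rho>\<^sub>0_def)
  finally have c_le: "c \<le> \<rho>\<^sub>0 ^ Suc d" .
  have "vabs (fls_nth ?g i) * \<rho> powi i \<le> \<rho>" if \<rho>: "\<rho>\<^sub>0 \<le> \<rho>" "\<rho> \<le> 1" for \<rho> i
  proof -
    have pos: "\<rho> > 0" using \<rho> \<rho>0 by linarith
    consider "i < - int d" | "i \<in> {- int d..0}" | "i \<ge> 1" by force
    then show ?thesis
    proof cases
      case 1
      then show ?thesis using pos by (simp add: g)
    next
      case 2
      have "\<rho>\<^sub>0 ^ Suc d \<le> \<rho> ^ Suc d" using \<rho> \<rho>0 by (intro power_mono) auto
      then have "vabs (fls_nth ?g i) \<le> \<rho> ^ Suc d" using c_ge[OF 2] c_le by linarith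
      moreover have "\<rho> powi i \<le> \<rho> powi (- int d)"
        using 2 \<rho> pos by (intro power_int_decreasing) auto
      ultimately have "vabs (fls_nth ?g i) * \<rho> powi i \<le> \<rho> ^ Suc d * \<rho> powi (- int d)"
        using pos by (intro mult_mono) auto
      also have "\<dots> = \<rho>" using pos by (simp add: power_int_minus)
      finally show ?thesis .
    next
      case 3
      then have "\<rho> powi i \<le> \<rho> powi 1" using pos \<rho> by (intro power_int_decreasing) auto
      then have "vabs (fls_nth ?g i) * \<rho> powi i \<le> 1 * \<rho>"
        using pos g_le by (intro mult_mono) auto
      then show ?thesis by simp
    qed
  qed
  then have "contracting_rem ?g \<rho>\<^sub>0" using \<rho>0 by unfold_locales auto
  then show ?thesis by (rule that)
qed

text \<open>Since s has no constant term, s^n does not reach degree m once n > m, so every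
  coefficient of \<phi>(h) is a finite sum, the one defining the composition.\<close>

lemma phi_power_series:
  fixes s :: "'a::nonarch_field fps"
  assumes nz: "fps_nth s d \<noteq> 0" and s0: "fps_nth s 0 = 0" and h: "\<And>n. n < 0 \<Longrightarrow> h n = 0"
  shows "phi d s h = laurent_of_fps (Abs_fps (\<lambda>n. h (int n)) oo s)"
proof
  fix m
  let ?f = "\<lambda>n. h n * fps_nth s d powi n * binomial_coeff (height_rem d s) n (m - int d * n)"
  have f: "?f (int n) = h (int n) * fls_nth (fps_to_fls (s ^ n)) m" for n
    unfolding binomial_coeff_height_rem[OF nz, symmetric] by (simp add: mult.assoc)
  have f_nz: "?f n = 0" if "n \<notin> int ` {0..nat m} \<or> m < 0" for n
  proof (cases "n < 0")
    case False
    then obtain k where k: "n = int k" using nonneg_int_cases by (metis not_less)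
    have "m < 0 \<or> nat m < k" using that k by force
    then have "fls_nth (fps_to_fls (s ^ k)) m = 0"
      using startsby_zero_power_prefix[OF s0, of k] by auto
    then show ?thesis unfolding k f by simp
  qed (simp add: h)
  have "(?f has_sum sum ?f (int ` {0..nat m})) UNIV"
    by (rule has_sum_finite_support) (use f_nz in blast)+
  then have "phi d s h m = sum ?f (int ` {0..nat m})"
    unfolding phi_def by (rule infsumI)
  also have "\<dots> = laurent_of_fps (Abs_fps (\<lambda>n. h (int n)) oo s) m"
  proof (cases "m < 0")
    case True
    then have "sum ?f (int ` {0..nat m}) = 0" using f_nz by (intro sum.neutral) blast
    then show ?thesis using True by (simp add: laurent_of_fps_def)
  next
    case False
    have "sum ?f (int ` {0..nat m}) = (\<Sum>n\<in>{0..nat m}. ?f (int n))"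
      by (subst sum.reindex) (auto simp: o_def)
    also have "\<dots> = (\<Sum>n\<in>{0..nat m}. h (int n) * fps_nth (s ^ n) (nat m))"
      unfolding f using False by simp
    finally show ?thesis using False by (simp add: laurent_of_fps_def fps_compose_nth)
  qed
  finally show "phi d s h m = laurent_of_fps (Abs_fps (\<lambda>n. h (int n)) oo s) m" .
qed

section \<open>Size of the coefficients of \<phi>(h)\<close>

context
  fixes s :: "'a::nonarch_field fps" and d :: nat and \<rho>\<^sub>0 :: real
  assumes height: "finite_height d s" and contr: "contracting_rem (height_rem d s) \<rho>\<^sub>0"
begin

interpretation contracting_rem "height_rem d s" "\<rho>\<^sub>0" by (rule contr)

lemma vabs_leading_coeff: "vabs (fps_nth s d) = 1" and height_ge_2: "d \<ge> 2"
  using height by (auto simp: finite_height_def)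

lemma phi_term_vabs:
  "vabs (h n * fps_nth s d powi n * binomial_coeff (height_rem d s) n (m - int d * n))
    = vabs (h n) * vabs (binomial_coeff (height_rem d s) n (m - int d * n))"
  by (simp add: vabs_mult vabs_power_int vabs_leading_coeff)

text \<open>The weight \<rho>^m splits as \<rho>^(dn), which goes with h_n, times \<rho>^(m-dn),
  which goes with the binomial coefficient; |s_d| = 1 removes the powers of s_d.\<close>

lemma phi_norm_le:
  assumes \<rho>: "\<rho>\<^sub>0 \<le> \<rho>" "\<rho> \<le> 1" and h: "\<And>n. vabs (h n) * (\<rho> ^ d) powi n \<le> C"
  shows "vabs (phi d s h m) * \<rho> powi m \<le> C"
proof -
  have "\<rho> > 0" using \<rho> \<rho>0 by linarith
  then have pos: "\<rho> powi i > 0" for i by simp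
  have "0 \<le> vabs (h 0) * (\<rho> ^ d) powi 0" by simp
  then have C: "0 \<le> C" using h by (rule order_trans)
  have "vabs (phi d s h m) \<le> C / \<rho> powi m"
    unfolding phi_def
  proof (rule infsum_vabs_le)
    fix n
    let ?b = "binomial_coeff (height_rem d s) n (m - int d * n)"
    have "(vabs (h n) * (\<rho> ^ d) powi n) * (vabs ?b * \<rho> powi (m - int d * n)) \<le> C * 1"
      using C \<open>\<rho> > 0\<close>
      by (intro mult_mono h binomial_coeff_bound \<rho> mult_nonneg_nonneg) simp_all
    moreover have \<rho>_split: "(\<rho> ^ d) powi n * \<rho> powi (m - int d * n) = \<rho> powi m"
    proof -
      have "(\<rho> ^ d) powi n = \<rho> powi (int d * n)" by (simp add: power_int_mult)
      then show ?thesis using \<open>\<rho> > 0\<close> by (simp flip: power_int_add)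
    qed
    have "(vabs (h n) * (\<rho> ^ d) powi n) * (vabs ?b * \<rho> powi (m - int d * n))
        = vabs (h n) * vabs ?b * \<rho> powi m"
      unfolding \<rho>_split[symmetric] by (simp only: ac_simps)
    ultimately have "vabs (h n) * vabs ?b * \<rho> powi m \<le> C" by simp
    then show "vabs (h n * fps_nth s d powi n * ?b) \<le> C / \<rho> powi m"
      unfolding phi_term_vabs using pos[of m] by (simp add: pos_le_divide_eq)
  qed (use C pos[of m] in simp)
  then show ?thesis using pos[of m] by (simp add: pos_le_divide_eq)
qed

text \<open>If $h_{-N}$ is the leftmost of the largest coefficients of the principal part of \<open>h\<close>, then the
  reduction of that principal part has a pole of order \<open>N\<close>, and substituting \<open>s\<close>, whose reduction
  vanishes to order \<open>d\<close> at 0, turns it into a pole of order $dN$.\<close>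

lemma phi_leading_pole:
  assumes complete: "complete (UNIV :: 'a set)"
    and tendsto: "\<And>e. e > 0 \<Longrightarrow> finite {n. n < 0 \<and> vabs (h n) \<ge> e}"
    and N: "h (- int N) \<noteq> 0" "N > 0"
    and le: "\<And>n. n < 0 \<Longrightarrow> vabs (h n) \<le> vabs (h (- int N))"
    and less: "\<And>n. n < - int N \<Longrightarrow> vabs (h n) < vabs (h (- int N))"
  shows "vabs (phi d s h (- int (d * N))) = vabs (h (- int N))"
proof -
  define b where "b = (\<lambda>n. binomial_coeff (height_rem d s) n (- int (d * N) - int d * n))"
  define f where "f = (\<lambda>n. h n * fps_nth s d powi n * b n)"
  have nz: "fps_nth s d \<noteq> 0" using vabs_leading_coeff by auto
  have f_vabs: "vabs (f n) = vabs (h n) * vabs (b n)" for n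
    unfolding f_def b_def by (rule phi_term_vabs)
  \<comment> \<open>Nonnegative powers of s contribute nothing in negative degree, so only the
    principal part of h is seen.\<close>
  have f_zero: "f n = 0" if n: "n \<ge> 0" for n
  proof -
    obtain k where k: "n = int k" using n by (rule nonneg_int_cases)
    have "fps_nth s d ^ k * b n = fls_nth (fps_to_fls (s ^ k)) (- int (d * N))"
      unfolding b_def k using binomial_coeff_height_rem[OF nz] by blast
    also have "\<dots> = 0" using N height_ge_2 by (simp add: not_less)
    finally show ?thesis using nz by (simp add: f_def k)
  qed
  have b_le: "vabs (b n) \<le> 1" for n
    using binomial_coeff_bound[of 1 n] \<rho>0 by (simp add: b_def)
  \<comment> \<open>\<open>b n\<close> is the coefficient of (1 + g)^n in degree -d(N + n). For n >
    -N this degree is negative and the coefficient is small; for n = -N it is 0 and the coefficient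
    is a unit; for n < -N the coefficient is at most 1, but there h_n is small.\<close>
  have b_less: "vabs (b n) < 1" if "n > - int N" for n
  proof -
    have "int d * (int N + n) > 0" using that height_ge_2 by simp
    then have "- int (d * N) - int d * n < 0" by (simp add: algebra_simps)
    then show ?thesis
      using binomial_coeff_diff_less[OF complete, of "- int (d * N) - int d * n" n]
      by (simp add: b_def)
  qed
  have "vabs (b (- int N) - 1) < 1"
    using binomial_coeff_diff_less[OF complete, of 0 "- int N"] by (simp add: b_def)
  then have "vabs (b (- int N)) = 1" using vabs_eq_of_diff_less[of "b (- int N)" 1] by simp
  then have f_N: "vabs (f (- int N)) = vabs (h (- int N))" by (simp add: f_vabs)
  have pos: "vabs (h (- int N)) > 0" using N by simp
  have "f summable_on UNIV"
  proof (rule nonarch_summable_on[OF complete])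
    fix e :: real assume e: "e > 0"
    have "{n \<in> UNIV. vabs (f n) \<ge> e} \<subseteq> {n. n < 0 \<and> vabs (h n) \<ge> e}"
    proof
      fix n assume "n \<in> {n \<in> UNIV. vabs (f n) \<ge> e}"
      then have n: "vabs (f n) \<ge> e" by simp
      then have "n < 0" using f_zero e by (cases "n < 0") auto
      moreover have "vabs (f n) \<le> vabs (h n)" by (simp add: f_vabs b_le mult_left_le)
      ultimately show "n \<in> {n. n < 0 \<and> vabs (h n) \<ge> e}" using n by simp
    qed
    then show "finite {n \<in> UNIV. vabs (f n) \<ge> e}" using tendsto[OF e] by (rule finite_subset)
  qed
  then have "(f has_sum phi d s h (- int (d * N))) UNIV"
    unfolding phi_def f_def b_def by (rule has_sum_infsum)
  then have "vabs (phi d s h (- int (d * N)) - f (- int N)) < vabs (h (- int N))"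
  proof (rule has_sum_vabs_diff_less)
    fix n assume "n \<in> UNIV - {- int N}"
    then consider "n \<ge> 0" | "n < - int N" | "- int N < n" "n < 0" by force
    then show "vabs (f n) < vabs (h (- int N))"
    proof cases
      case 2
      have "vabs (f n) \<le> vabs (h n)" by (simp add: f_vabs b_le mult_left_le)
      then show ?thesis using less[OF 2] by simp
    next
      case 3
      have "vabs (f n) \<le> vabs (h (- int N)) * vabs (b n)"
        unfolding f_vabs using le[OF 3(2)] by (intro mult_right_mono) auto
      also have "\<dots> < vabs (h (- int N)) * 1" using b_less[OF 3(1)] pos by (intro mult_strict_left_mono)
      finally show ?thesis by simp
    qed (use f_zero pos in simp)
  qed (use pos in auto)
  then show ?thesis using vabs_eq_of_diff_less f_N by metis
qed

end

section \<open>Eigenvectors in the Robba ring\<close>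

context
  fixes s :: "'a::nonarch_field fps" and d :: nat and \<rho>\<^sub>0 :: real
    and h :: "int \<Rightarrow> 'a" and \<mu> :: 'a and R :: real
  assumes height: "finite_height d s" and contr: "contracting_rem (height_rem d s) \<rho>\<^sub>0"
    and R: "\<rho>\<^sub>0 \<le> R" "R < 1"
    and h: "h \<in> laurent_on {R..<1}"
    and eigen: "phi d s h = (\<lambda>n. \<mu> * h n)"
begin

interpretation contracting_rem "height_rem d s" "\<rho>\<^sub>0" by (rule contr)

lemma R_pos: "R > 0"
  using R \<rho>0 by linarith

lemma laurent_tendsto:
  "(\<lambda>n. vabs (h (int n)) * R ^ n) \<longlonglongrightarrow> 0"
  "(\<lambda>n. vabs (h (- int n)) * R powi (- int n)) \<longlonglongrightarrow> 0"
  using h R R_pos by (auto simp: laurent_on_def)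

lemma laurent_bounded: "\<exists>C. \<forall>n. vabs (h n) * R powi n \<le> C"
proof -
  have "Bseq (\<lambda>n. vabs (h (int n)) * R ^ n)" "Bseq (\<lambda>n. vabs (h (- int n)) * R powi (- int n))"
    using laurent_tendsto by (auto intro!: convergent_imp_Bseq simp: convergent_def)
  then obtain A B where A: "\<And>n. norm (vabs (h (int n)) * R ^ n) \<le> A"
    and B: "\<And>n. norm (vabs (h (- int n)) * R powi (- int n)) \<le> B"
    unfolding Bseq_def by blast
  have "vabs (h n) * R powi n \<le> max A B" for n
  proof (cases n rule: int_cases2)
    case (nonneg k)
    then show ?thesis using A[of k] R_pos by simp
  next
    case (nonpos k)
    then show ?thesis using B[of k] R_pos by simp
  qed
  then show ?thesis by blast
qed

text \<open>From $|\phi(h)|_\rho \le |h|_{\rho^d}$ one gets $|h|_{R^{1/d^k}} \le |\mu|^{-k} |h|_R$, while the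
  left-hand side stays away from 0 as \<open>k\<close> grows.\<close>

lemma eigenvalue_vabs_le_1:
  assumes nonzero: "h n\<^sub>0 \<noteq> 0"
  shows "vabs \<mu> \<le> 1"
proof (rule ccontr)
  assume "\<not> vabs \<mu> \<le> 1"
  then have \<mu>: "vabs \<mu> > 1" by simp
  have d: "d \<ge> 2" using height_ge_2[OF height contr] .
  obtain C where C: "\<And>n. vabs (h n) * R powi n \<le> C" using laurent_bounded by blast
  \<comment> \<open>The witness is the d^k-th root of R: each step takes a d-th root, which stays in
    [R, 1), and gains a factor |\<mu>| from the eigenvalue equation.\<close>
  have "\<exists>\<rho>. R \<le> \<rho> \<and> \<rho> < 1 \<and> (\<forall>n. vabs \<mu> ^ k * (vabs (h n) * \<rho> powi n) \<le> C)" for k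
  proof (induction k)
    case 0
    then show ?case using C R by auto
  next
    case (Suc k)
    then obtain \<rho> where \<rho>: "R \<le> \<rho>" "\<rho> < 1"
      and le: "\<And>n. vabs \<mu> ^ k * (vabs (h n) * \<rho> powi n) \<le> C" by blast
    define \<sigma> where "\<sigma> = root d \<rho>"
    have "vabs \<mu> > 0" using \<mu> by linarith
    then have pos: "\<rho> > 0" "\<sigma> > 0" "vabs \<mu> ^ k > 0"
      using \<rho> R_pos d by (auto simp: \<sigma>_def simp del: vabs_pos_iff)
    have \<sigma>_pow: "\<sigma> ^ d = \<rho>" using d pos by (simp add: \<sigma>_def)
    have \<sigma>_less: "\<sigma> < 1" using \<rho> d by (simp add: \<sigma>_def)
    have "\<sigma> ^ d \<le> \<sigma> ^ 1" using d pos \<sigma>_less by (intro power_decreasing) auto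
    then have \<sigma>_ge: "R \<le> \<sigma>" using \<rho> \<sigma>_pow by simp
    have "vabs \<mu> ^ Suc k * (vabs (h m) * \<sigma> powi m) \<le> C" for m
    proof -
      have "vabs (phi d s h m) * \<sigma> powi m \<le> C / vabs \<mu> ^ k"
      proof (rule phi_norm_le[OF height contr])
        show "vabs (h n) * (\<sigma> ^ d) powi n \<le> C / vabs \<mu> ^ k" for n
          unfolding \<sigma>_pow using le[of n] pos by (simp add: pos_le_divide_eq mult.commute)
      qed (use \<sigma>_ge \<sigma>_less R in auto)
      then show ?thesis using pos by (simp add: eigen vabs_mult pos_le_divide_eq ac_simps)
    qed
    then show ?case using \<sigma>_ge \<sigma>_less by blast
  qed
  then obtain \<rho> where \<rho>: "\<And>k. R \<le> \<rho> k" "\<And>k. \<rho> k < 1"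
    and le: "\<And>k n. vabs \<mu> ^ k * (vabs (h n) * \<rho> k powi n) \<le> C" by metis
  \<comment> \<open>R^|n_0| is a lower bound for \<rho>^(n_0) throughout [R, 1): by monotonicity if
    n_0 \<ge> 0, and because \<rho>^(n_0) \<ge> 1 \<ge> R^|n_0| if n_0 < 0.\<close>
  define c where "c = vabs (h n\<^sub>0) * R ^ nat \<bar>n\<^sub>0\<bar>"
  have c: "c > 0" using nonzero R_pos by (simp add: c_def)
  have "R ^ nat \<bar>n\<^sub>0\<bar> \<le> \<rho> k powi n\<^sub>0" for k
  proof (cases "n\<^sub>0 \<ge> 0")
    case True
    then show ?thesis using \<rho>[of k] R_pos by (simp add: power_int_def power_mono)
  next
    case False
    then have "1 \<le> \<rho> k powi n\<^sub>0"
      using \<rho>[of k] R_pos power_int_decreasing[of n\<^sub>0 0 "\<rho> k"] by simp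
    moreover have "R ^ nat \<bar>n\<^sub>0\<bar> \<le> 1" using R_pos R by (simp add: power_le_one)
    ultimately show ?thesis by linarith
  qed
  then have "vabs \<mu> ^ k * c \<le> vabs \<mu> ^ k * (vabs (h n\<^sub>0) * \<rho> k powi n\<^sub>0)" for k
    unfolding c_def by (intro mult_left_mono) auto
  then have "vabs \<mu> ^ k * c \<le> C" for k using le by (rule order_trans)
  then have "vabs \<mu> ^ k \<le> C / c" for k using c by (simp add: pos_le_divide_eq)
  moreover obtain k where "C / c < vabs \<mu> ^ k" using real_arch_pow[OF \<mu>] by blast
  ultimately show False by (simp add: not_le[symmetric])
qed

lemma eigenvector_no_principal_part:
  assumes complete: "complete (UNIV :: 'a set)" and \<mu>: "vabs \<mu> \<le> 1" and n: "n < 0"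
  shows "h n = 0"
proof (rule ccontr)
  assume "h n \<noteq> 0"
  have d: "d \<ge> 2" using height_ge_2[OF height contr] .
  \<comment> \<open>Since R < 1, negative powers of R are at least 1, so the coefficients of the
    principal part tend to 0 even unweighted. Hence their maximum is attained, and only finitely
    often.\<close>
  have fin: "finite {n. n < 0 \<and> vabs (h n) \<ge> e}" if e: "e > 0" for e
  proof -
    obtain J where J: "\<And>j. j \<ge> J \<Longrightarrow> vabs (h (- int j)) * R powi (- int j) < e"
      using order_tendstoD(2)[OF laurent_tendsto(2) e] by (auto simp: eventually_sequentially)
    have "{n. n < 0 \<and> vabs (h n) \<ge> e} \<subseteq> {- int J..0}"
    proof
      fix n assume n: "n \<in> {n. n < 0 \<and> vabs (h n) \<ge> e}"
      then have "1 \<le> R powi n"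
        using R_pos R power_int_decreasing[of n 0 R] by simp
      then have "vabs (h n) * 1 \<le> vabs (h n) * R powi n" by (intro mult_left_mono) auto
      then have "e \<le> vabs (h (- int (nat (- n)))) * R powi (- int (nat (- n)))" using n by simp
      then have "nat (- n) < J" using J[of "nat (- n)"] by (meson not_le)
      then show "n \<in> {- int J..0}" using n by auto
    qed
    then show ?thesis by (rule finite_subset) simp
  qed
  \<comment> \<open>Indices outside S have coefficients smaller than h_n, so the maximum over the
    finite set S is the maximum over all negative indices; the least index attaining it gives the
    pole order N.\<close>
  define S where "S = {k. k < 0 \<and> vabs (h k) \<ge> vabs (h n)}"
  have S: "finite S" "n \<in> S" using fin \<open>h n \<noteq> 0\<close> n by (auto simp: S_def)
  define M where "M = Max ((\<lambda>k. vabs (h k)) ` S)"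
  have M_in: "M \<in> (\<lambda>k. vabs (h k)) ` S" unfolding M_def using S by (intro Max_in) auto
  have "vabs (h k) \<le> M" if "k \<in> S" for k unfolding M_def using S that by (intro Max_ge) auto
  then have M_ge: "vabs (h k) \<le> M" if "k < 0" for k
    using that S by (cases "k \<in> S") (fastforce simp: S_def)+
  define T where "T = {k \<in> S. vabs (h k) = M}"
  have T: "finite T" "T \<noteq> {}" using S M_in by (auto simp: T_def)
  define N where "N = nat (- Min T)"
  have "Min T \<in> T" using T by (rule Min_in)
  then have N: "N > 0" "- int N \<in> T" "- int N = Min T" by (auto simp: N_def T_def S_def)
  have "M > 0" using M_ge[OF n] \<open>h n \<noteq> 0\<close> less_le_trans[of 0 "vabs (h n)" M] by simp
  moreover have "vabs (h (- int N)) = M" using N(2) by (simp add: T_def)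
  ultimately have h_N: "vabs (h (- int N)) = M" "h (- int N) \<noteq> 0" by auto
  have less: "vabs (h k) < M" if k: "k < - int N" for k
  proof -
    have "k \<notin> T" using Min_le[OF T(1), of k] k N(3) by auto
    moreover have "k < 0" using k by simp
    moreover have "k \<in> S" if "vabs (h k) = M"
      using that M_ge[OF n] \<open>k < 0\<close> by (simp add: S_def)
    ultimately show ?thesis using M_ge[of k] by (auto simp: T_def order_less_le)
  qed
  have "vabs (phi d s h (- int (d * N))) = M"
    using phi_leading_pole[OF height contr complete fin h_N(2) N(1)] M_ge less h_N by simp
  then have "vabs \<mu> * vabs (h (- int (d * N))) = M" by (simp add: eigen vabs_mult)
  moreover have "vabs \<mu> * vabs (h (- int (d * N))) \<le> 1 * vabs (h (- int (d * N)))"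
    using \<mu> by (intro mult_right_mono) auto
  \<comment> \<open>As d \<ge> 2, degree -dN lies strictly to the left of the leftmost
    maximum.\<close>
  moreover have "vabs (h (- int (d * N))) < M"
  proof (rule less)
    have "int N * 2 \<le> int N * int d" using d by (intro mult_left_mono) auto
    then show "- int (d * N) < - int N" using N(1) by (simp add: mult.commute)
  qed
  ultimately show False by simp
qed

end

theorem theorem6p3:
  fixes p :: nat and W :: "'a::nonarch_field set" and red :: "'a \<Rightarrow> 'k::field"
    and s :: "'a fps" and d :: nat and \<mu> :: 'a and h :: "int \<Rightarrow> 'a"
  assumes "totally_ramified_over_witt p W red"
    and "finite_height d s"
    and "\<mu> \<noteq> 1"
    and "h \<in> robba"
    and "h \<noteq> (\<lambda>n. 0)"
    and "phi d s h = (\<lambda>n. \<mu> * h n)"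
  shows "fps_nth (fps_deriv s) 0 \<noteq> 0 \<and>
    (\<exists>k::nat. k \<ge> 1 \<and> \<mu> = fps_nth (fps_deriv s) 0 ^ k \<and>
      (\<exists>c::'a. h = (\<lambda>n. c * laurent_of_fps (log_series s ^ k) n)))"
proof -
  have complete: "complete (UNIV :: 'a set)"
    using assms(1) by (rule totally_ramified_over_witt.complete_UNIV_K)
  obtain \<rho>\<^sub>0 where contr: "contracting_rem (height_rem d s) \<rho>\<^sub>0"
    using finite_height_contracting[OF assms(2)] .
  then have \<rho>0: "\<rho>\<^sub>0 < 1" by (rule contracting_rem.\<rho>0)
  obtain r where r: "r < 1" "h \<in> laurent_on {r..<1}" using assms(4) by (auto simp: robba_def)
  define R where "R = max r \<rho>\<^sub>0"
  have R: "\<rho>\<^sub>0 \<le> R" "R < 1" using r \<rho>0 by (auto simp: R_def)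
  have h: "h \<in> laurent_on {R..<1}"
  proof -
    have "{R..<1} \<subseteq> {r..<1}" by (auto simp: R_def)
    then show ?thesis using r(2) unfolding laurent_on_def by blast
  qed
  obtain n\<^sub>0 where "h n\<^sub>0 \<noteq> 0" using assms(5) by auto
  then have "vabs \<mu> \<le> 1" by (rule eigenvalue_vabs_le_1[OF assms(2) contr R h assms(6)])
  then have neg: "h n = 0" if "n < 0" for n
    using eigenvector_no_principal_part[OF assms(2) contr R h assms(6) complete] that by blast
  define H where "H = Abs_fps (\<lambda>n. h (int n))"
  have h_H: "h = laurent_of_fps H"
    using neg by (auto simp: laurent_of_fps_def H_def)
  \<comment> \<open>d \<ge> 2 puts s_1 among the coefficients in the maximal ideal; |s'(0)| < 1 then
    excludes roots of unity and makes the product for the logarithm converge.\<close>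
  have d: "d \<ge> 2" and s0: "fps_nth s 0 = 0" and sd: "vabs (fps_nth s d) = 1"
    and small: "vabs (fps_nth s 1) < 1"
    using assms(2) by (auto simp: finite_height_def)
  have nz: "fps_nth s d \<noteq> 0" "s \<noteq> 0" using sd by auto
  have "laurent_of_fps (H oo s) = phi d s h"
    unfolding H_def using phi_power_series[where h = h, OF nz(1) s0 neg] by simp
  then have "laurent_of_fps (H oo s) = (\<lambda>n. \<mu> * laurent_of_fps H n)"
    unfolding assms(6) by (simp flip: h_H)
  then have "laurent_of_fps (H oo s) (int n) = \<mu> * laurent_of_fps H (int n)" for n by simp
  then have eigen: "H oo s = fps_const \<mu> * H"
    by (intro fps_ext) (simp add: laurent_of_fps_def)
  have "H \<noteq> 0" using h_H assms(5) by (auto simp: laurent_of_fps_def)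
  note eigenvalue = eigenseries_eigenvalue[OF s0 nz(2) this eigen assms(3)]
  define k where "k = subdegree H"
  have s1_pow: "fps_nth s 1 ^ n \<noteq> 1" if "n \<ge> 1" for n
  proof
    assume "fps_nth s 1 ^ n = 1"
    then have "vabs (fps_nth s 1) ^ n = 1" by (simp flip: vabs_power)
    moreover have "vabs (fps_nth s 1) ^ n \<le> vabs (fps_nth s 1) ^ 1"
      using that small by (intro power_decreasing) auto
    ultimately show False using small by simp
  qed
  have "H = fps_const (fps_nth H k) * log_series s ^ k"
    unfolding log_series_eq[OF s0 eigenvalue(2) small] k_def
    using eigen eigenvalue by (intro eigenseries_unique s0 s1_pow \<open>H \<noteq> 0\<close>) auto
  then have "h = laurent_of_fps (fps_const (fps_nth H k) * log_series s ^ k)"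
    using h_H by simp
  also have "\<dots> = (\<lambda>n. fps_nth H k * laurent_of_fps (log_series s ^ k) n)"
    by (auto simp: laurent_of_fps_def)
  finally have "h = (\<lambda>n. fps_nth H k * laurent_of_fps (log_series s ^ k) n)" .
  then show ?thesis using eigenvalue by (auto simp: k_def)
qed

end
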